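(* Let $K>0$, $p\ge1$, $\alpha(0)\in[-\pi,\pi]$ and $\beta(0)\in[0,1)$, and let $(\alpha_N(0),\beta_N(0))_{N\ge3}$ be a sequence in $[-\pi,\pi]\times[0,1)$ with $\alpha_N(0)\to\alpha(0)$ and $\beta_N(0)\to\beta(0)$ as $N\to\infty$. For each $N$ let $\theta^N(t)=\theta(\alpha_N(t),\beta_N(t),A_N(t))$ be the corresponding trajectory of the Kuramoto model on $W^{\mathrm u}(\theta^N_{\alpha(0)})$, and let $(\alpha(t),\beta(t))$ be the reduced Ott–Antonsen dynamics started at $(\alpha(0),\beta(0))$ (all defined in the context). 1. If $\beta(0)\in(0,1)$, then $$\lim_{N\to+\infty}\ \sup_{t\ge0}\ W_p\left(\mu^N(\theta^N(t)),\,f_{\alpha(t),\beta(t)}\right)=0.$$ 2. If $\beta(0)=0$, then for every sequence of times $(T_N)$ with $T_N\to+\infty$ and $\beta_N(0)e^{KT_N}\to0$ as $N\to+\infty$, $$\lim_{N\to+\infty}\ \sup_{t\in[0,T_N]}\ W_p\left(\mu^N(\theta^N(t)),\,f_{\alpha(t),\beta(t)}\right)=0.$$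
   Context: $\mathbb{T}=\mathbb{R}/2\pi\mathbb{Z}=\mathbb{S}^1$ with arc-length distance, $W_p$ the $p$-Wasserstein distance on probability measures on $\mathbb{T}$, $\mu^N(x)=\frac1N\sum_{i=1}^N\delta_{x_i}$ for $x\in\mathbb{T}^N$. $f_{\alpha,\beta}(\theta)=\frac1{2\pi}\frac{1-\beta^2}{1-2\beta\cos(\alpha+\theta)+\beta^2}$, identified with the probability measure $f_{\alpha,\beta}\,d\theta$. The reduced Ott–Antonsen dynamics is $\dot\beta=\frac K2\beta(1-\beta^2)$, $\dot\alpha=0$. For $\alpha,A\in\mathbb{R}$, $\beta\in[0,1)$, $\xi\in[0,1]$, $$\phi(\alpha,\beta,A,\xi)=2\arctan\left(\frac{1-\beta}{1+\beta}\tan(\pi\xi+A)\right)-\alpha+2\pi k,$$ with $k\in\mathbb{Z}$ such that $\pi\xi+A\in[\pi(k-\frac12),\pi(k+\frac12)]$ (extended by continuity where $\tan$ is infinite); $\phi_i(\alpha,\beta,A)=\phi(\alpha,\beta,A,\frac{2i-1}{2N})$, and $\theta(\alpha,\beta,A)=(\phi_i(\alpha,\beta,A))_{i=1}^N$ mod $2\pi$, in $\mathbb{T}^N$. For $q\in\mathbb{T}$, $W^{\mathrm u}(\theta^N_q)$ denotes the unstable manifold of the equilibrium $\theta^N_q=(\frac{\pi(2i-1-N)}N+q)_{i=1}^N$ of the Kuramoto model $\dot\theta_i=\frac KN\sum_{j}\sin(\theta_j-\theta_i)$; it consists of the points $\theta(\alpha,\beta,A)$ with $\beta\in[0,1)$,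 $\alpha\in[-\pi,\pi]$, $A\in[-\frac\pi2,\frac\pi2]$ and $\frac1N\sum_i\phi_i(\alpha,\beta,A)=q$ mod $2\pi$. $(\alpha_N(t),\beta_N(t),A_N(t))$ is the solution of $$\dot\beta=\tfrac K2\beta(1-\beta^2)B_N(A,\beta),\quad \dot\alpha=\tfrac K2(1+\beta^2)D_N(A,\beta),\quad \dot A=\tfrac K4(1-\beta^2)D_N(A,\beta),$$ $$B_N(A,\beta)=\frac{1+\beta^{2N-2}+\cos(2AN)(-\beta)^{N-2}(1+\beta^2)}{1+\beta^{2N}+2(-\beta)^N\cos(2AN)},\quad D_N(A,\beta)=\frac{\sin(2AN)(-\beta)^{N-2}(\beta^2-1)}{1+\beta^{2N}+2(-\beta)^N\cos(2AN)},$$ with initial values $\alpha_N(0),\beta_N(0)$ and $A_N(0)\in[-\frac\pi2,\frac\pi2]$ chosen so that $\frac1N\sum_i\phi_i(\alpha_N(0),\beta_N(0),A_N(0))=\alpha(0)$ mod $2\pi$, i.e. $\theta(\alpha_N(0),\beta_N(0),A_N(0))\in W^{\mathrm u}(\theta^N_{\alpha(0)})$; then $\theta^N(t)=\theta(\alpha_N(t),\beta_N(t),A_N(t))$ is a trajectory of the Kuramoto model in $W^{\mathrm u}(\theta^N_{\alpha(0)})$. *)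

theory Defs
  imports "HOL-Probability.Probability"
begin

section \<open>The circle \<open>\<real>/2\<pi>\<int>\<close> with arc-length distance\<close>

quotient_type torus = real / "\<lambda>x y. \<exists>k::int. x - y = 2 * pi * of_int k"
  morphisms rep_torus to_torus
proof (rule equivpI)
  show "reflp (\<lambda>x y. \<exists>k::int. x - y = 2 * pi * of_int k)"
    by (auto intro!: reflpI exI[of _ 0])
  show "symp (\<lambda>x y. \<exists>k::int. x - y = 2 * pi * of_int k)"
  proof (rule sympI)
    fix x y assume "\<exists>k::int. x - y = 2 * pi * of_int k"
    then obtain k :: int where "x - y = 2 * pi * of_int k" by blast
    then have "y - x = 2 * pi * of_int (- k)" by simp
    then show "\<exists>k::int. y - x = 2 * pi * of_int k" by blast
  qed
  show "transp (\<lambda>x y. \<exists>k::int. x - y = 2 * pi * of_int k)"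
  proof (rule transpI)
    fix x y z
    assume "\<exists>k::int. x - y = 2 * pi * of_int k" "\<exists>k::int. y - z = 2 * pi * of_int k"
    then obtain k l :: int where "x - y = 2 * pi * of_int k" "y - z = 2 * pi * of_int l" by blast
    then have "x - z = 2 * pi * of_int (k + l)" by (simp add: algebra_simps)
    then show "\<exists>k::int. x - z = 2 * pi * of_int k" by blast
  qed
qed

definition arc_length :: "real \<Rightarrow> real" where
  "arc_length z = (INF k::int. \<bar>z + 2 * pi * of_int k\<bar>)"

lemma bdd_below_arc: "bdd_below (range (\<lambda>k::int. \<bar>z + 2 * pi * of_int k\<bar>))"
  by (rule bdd_belowI[of _ 0]) auto

lemma arc_length_le: "arc_length z \<le> \<bar>z + 2 * pi * of_int k\<bar>"
  unfolding arc_length_def by (rule cINF_lower[OF bdd_below_arc]) simp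

lemma arc_length_attained:
  obtains k :: int where "arc_length z = \<bar>z + 2 * pi * of_int k\<bar>"
proof -
  define k where "k = - round (z / (2 * pi))"
  have "\<bar>z + 2 * pi * of_int k\<bar> \<le> \<bar>z + 2 * pi * of_int l\<bar>" for l :: int
  proof -
    have scale: "\<bar>z + 2 * pi * of_int m\<bar> = 2 * pi * \<bar>z / (2 * pi) - of_int (- m)\<bar>" for m :: int
    proof -
      have "z + 2 * pi * of_int m = 2 * pi * (z / (2 * pi) - of_int (- m))"
        by (simp add: field_simps)
      then show ?thesis by (simp add: abs_mult)
    qed
    show ?thesis
      unfolding scale k_def using round_diff_minimal[of "z / (2 * pi)" "- l"]
      by (intro mult_left_mono) auto
  qed
  then have "\<bar>z + 2 * pi * of_int k\<bar> \<le> arc_length z"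
    unfolding arc_length_def by (intro cINF_greatest) auto
  with arc_length_le[of z k] have "arc_length z = \<bar>z + 2 * pi * of_int k\<bar>" by simp
  then show ?thesis by (rule that)
qed

lemma arc_length_nonneg: "0 \<le> arc_length z"
  by (rule arc_length_attained[of z]) simp

lemma arc_length_shift: "arc_length (z + 2 * pi * of_int m) = arc_length z"
proof (rule antisym)
  obtain k :: int where k: "arc_length z = \<bar>z + 2 * pi * of_int k\<bar>"
    by (rule arc_length_attained)
  show "arc_length (z + 2 * pi * of_int m) \<le> arc_length z"
    using arc_length_le[of "z + 2 * pi * of_int m" "k - m"] k by (simp add: algebra_simps)
  obtain l :: int where l: "arc_length (z + 2 * pi * of_int m)
      = \<bar>z + 2 * pi * of_int m + 2 * pi * of_int l\<bar>"
    by (rule arc_length_attained)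
  show "arc_length z \<le> arc_length (z + 2 * pi * of_int m)"
    using arc_length_le[of z "m + l"] l by (simp add: algebra_simps)
qed

lemma arc_length_minus: "arc_length (- z) = arc_length z"
proof -
  have "arc_length (- w) \<le> arc_length w" for w
  proof -
    obtain k :: int where k: "arc_length w = \<bar>w + 2 * pi * of_int k\<bar>"
      by (rule arc_length_attained)
    show ?thesis using arc_length_le[of "- w" "- k"] k by simp
  qed
  from this[of z] this[of "- z"] show ?thesis by simp
qed

lemma arc_length_add: "arc_length (z + w) \<le> arc_length z + arc_length w"
proof -
  obtain k :: int where k: "arc_length z = \<bar>z + 2 * pi * of_int k\<bar>"
    by (rule arc_length_attained)
  obtain l :: int where l: "arc_length w = \<bar>w + 2 * pi * of_int l\<bar>"
    by (rule arc_length_attained)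
  have "arc_length (z + w) \<le> \<bar>(z + 2 * pi * of_int k) + (w + 2 * pi * of_int l)\<bar>"
    using arc_length_le[of "z + w" "k + l"] by (simp add: algebra_simps)
  then show ?thesis using k l by linarith
qed

lemma arc_length_eq_0_iff: "arc_length z = 0 \<longleftrightarrow> (\<exists>k::int. z = 2 * pi * of_int k)"
proof
  assume z: "arc_length z = 0"
  obtain k :: int where "arc_length z = \<bar>z + 2 * pi * of_int k\<bar>"
    by (rule arc_length_attained)
  with z have "z = 2 * pi * of_int (- k)" by simp
  then show "\<exists>k::int. z = 2 * pi * of_int k" by blast
next
  assume "\<exists>k::int. z = 2 * pi * of_int k"
  then obtain k :: int where "z = 2 * pi * of_int k" by blast
  with arc_length_le[of z "- k"] arc_length_nonneg[of z] show "arc_length z = 0" by simp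
qed

instantiation torus :: metric_space
begin

lift_definition dist_torus :: "torus \<Rightarrow> torus \<Rightarrow> real" is "\<lambda>x y. arc_length (x - y)"
proof -
  fix x x' y y' :: real
  assume "\<exists>k::int. x - x' = 2 * pi * of_int k" "\<exists>k::int. y - y' = 2 * pi * of_int k"
  then obtain k l :: int where "x - x' = 2 * pi * of_int k" "y - y' = 2 * pi * of_int l" by blast
  then have "x - y = x' - y' + 2 * pi * of_int (k - l)" by (simp add: algebra_simps)
  then show "arc_length (x - y) = arc_length (x' - y')" by (simp only: arc_length_shift)
qed

definition uniformity_torus :: "(torus \<times> torus) filter" where
  "uniformity_torus = (INF e\<in>{0<..}. principal {(x, y). dist x y < e})"

definition open_torus :: "torus set \<Rightarrow> bool" where
  "open_torus U \<longleftrightarrow> (\<forall>x\<in>U. eventually (\<lambda>(x', y). x' = x \<longrightarrow> y \<in> U) uniformity)"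

instance
proof
  fix x y z :: torus and U :: "torus set"
  show "dist x y = 0 \<longleftrightarrow> x = y"
    by transfer (rule arc_length_eq_0_iff)
  show "dist x y \<le> dist x z + dist y z"
  proof transfer
    fix x y z :: real
    show "arc_length (x - y) \<le> arc_length (x - z) + arc_length (y - z)"
      using arc_length_add[of "x - z" "z - y"] arc_length_minus[of "y - z"] by simp
  qed
qed (simp_all add: uniformity_torus_def open_torus_def)

end

lemma dist_to_torus: "dist (to_torus x) (to_torus y) = arc_length (x - y)"
  by (rule dist_torus.abs_eq)

lemma dist_to_torus_le: "dist (to_torus x) (to_torus y) \<le> dist x y"
  using arc_length_le[of "x - y" 0] by (simp add: dist_to_torus dist_real_def)

lemma measurable_to_torus [measurable]: "to_torus \<in> borel_measurable borel"
proof (rule borel_measurable_continuous_onI)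
  show "continuous_on UNIV to_torus"
    unfolding continuous_on_iff by (blast intro: le_less_trans[OF dist_to_torus_le])
qed

instance torus :: second_countable_topology
proof
  define B where "B = (\<lambda>(q, r). ball (to_torus q) r) ` (\<rat> \<times> \<rat>)"
  have "topological_basis B"
  proof (rule topological_basisI)
    show "open U" if "U \<in> B" for U
      using that by (auto simp: B_def)
    fix U :: "torus set" and x assume "open U" "x \<in> U"
    then obtain e where e: "e > 0" "ball x e \<subseteq> U"
      by (meson open_contains_ball)
    obtain x' where x': "x = to_torus x'" by (induct x) blast
    obtain r where r: "r \<in> \<rat>" "0 < r" "r < e / 2"
      using Rats_dense_in_real[of 0 "e / 2"] e by auto
    obtain q where q: "q \<in> \<rat>" "x' - r < q" "q < x'"
      using Rats_dense_in_real[of "x' - r" x'] r by auto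
    have d: "dist (to_torus q) x < r"
      using dist_to_torus_le[of q x'] q by (simp add: x' dist_real_def)
    have "ball (to_torus q) r \<subseteq> U"
    proof
      fix y assume "y \<in> ball (to_torus q) r"
      then have "dist x y < e"
        using d r dist_triangle[of x y "to_torus q"] by (simp add: dist_commute)
      with e show "y \<in> U" by auto
    qed
    with d q r show "\<exists>V\<in>B. x \<in> V \<and> V \<subseteq> U"
      by (intro bexI[of _ "ball (to_torus q) r"]) (auto simp: B_def)
  qed
  moreover have "countable B"
    unfolding B_def by (intro countable_image countable_SIGMA countable_rat)
  ultimately show "\<exists>B::torus set set. countable B \<and> open = generate_topology B"
    by (blast intro: topological_basis_imp_subbasis)
qed


section \<open>Wasserstein distance and the measures involved\<close>

definition coupling :: "'a::{metric_space, second_countable_topology} measure \<Rightarrow> 'a measure \<Rightarrow> ('a \<times> 'a) measure \<Rightarrow> bool" where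
  "coupling \<mu> \<nu> \<gamma> \<longleftrightarrow> prob_space \<gamma> \<and> sets \<gamma> = sets (borel \<Otimes>\<^sub>M borel) \<and>
     distr \<gamma> borel fst = \<mu> \<and> distr \<gamma> borel snd = \<nu>"

definition transport_cost :: "real \<Rightarrow> 'a::{metric_space, second_countable_topology} measure \<Rightarrow> 'a measure \<Rightarrow> ennreal" where
  "transport_cost p \<mu> \<nu> =
     (INF \<gamma>\<in>{\<gamma>. coupling \<mu> \<nu> \<gamma>}. \<integral>\<^sup>+z. ennreal (dist (fst z) (snd z) powr p) \<partial>\<gamma>)"

text \<open>The case distinction only spells out the \<open>p\<close>-th root on \<^typ>\<open>ennreal\<close>.\<close>

definition wasserstein :: "real \<Rightarrow> 'a::{metric_space, second_countable_topology} measure \<Rightarrow> 'a measure \<Rightarrow> ennreal" where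
  "wasserstein p \<mu> \<nu> =
     (if transport_cost p \<mu> \<nu> = \<top> then \<top>
      else ennreal (enn2real (transport_cost p \<mu> \<nu>) powr (1 / p)))"

text \<open>Points of \<open>\<T>\<^sup>N\<close> are families indexed by \<open>1, \<dots>, N\<close>; other indices are ignored.\<close>

definition empirical_measure :: "nat \<Rightarrow> (nat \<Rightarrow> torus) \<Rightarrow> torus measure" where
  "empirical_measure N x =
     measure_of UNIV (sets borel) (\<lambda>E. ennreal (1 / real N) * (\<Sum>i=1..N. emeasure (return borel (x i)) E))"

lemma sets_empirical_measure: "sets (empirical_measure N x) = sets borel"
  unfolding empirical_measure_def
  by (metis sets.sets_measure_of_eq space_borel)

lemma emeasure_empirical_measure:
  assumes "E \<in> sets borel"
  shows "emeasure (empirical_measure N x) E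
    = ennreal (1 / real N) * (\<Sum>i=1..N. emeasure (return borel (x i)) E)"
proof (rule emeasure_measure_of[OF empirical_measure_def])
  show "sets borel \<subseteq> Pow (UNIV :: torus set)" by simp
  show "E \<in> sets (empirical_measure N x)" using assms by (simp add: sets_empirical_measure)
  show "positive (sets (empirical_measure N x))
      (\<lambda>E. ennreal (1 / real N) * (\<Sum>i=1..N. emeasure (return borel (x i)) E))"
    by (simp add: positive_def)
  show "countably_additive (sets (empirical_measure N x))
      (\<lambda>E. ennreal (1 / real N) * (\<Sum>i=1..N. emeasure (return borel (x i)) E))"
  proof (rule countably_additiveI)
    fix A :: "nat \<Rightarrow> torus set"
    assume A: "range A \<subseteq> sets (empirical_measure N x)" "disjoint_family A"
    have "(\<Sum>n. emeasure (return borel (x i)) (A n)) = emeasure (return borel (x i)) (\<Union>n. A n)" for i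
      using A by (intro suminf_emeasure) (auto simp: sets_empirical_measure)
    then show "(\<Sum>n. ennreal (1 / real N) * (\<Sum>i=1..N. emeasure (return borel (x i)) (A n)))
       = ennreal (1 / real N) * (\<Sum>i=1..N. emeasure (return borel (x i)) (\<Union>n. A n))"
      by (simp add: suminf_sum)
  qed
qed

definition OA_density :: "real \<Rightarrow> real \<Rightarrow> real \<Rightarrow> real" where
  "OA_density \<alpha> \<beta> \<theta> = 1 / (2 * pi) * ((1 - \<beta>\<^sup>2) / (1 - 2 * \<beta> * cos (\<alpha> + \<theta>) + \<beta>\<^sup>2))"

text \<open>The measure \<open>f\<^sub>\<alpha>\<^sub>,\<^sub>\<beta> d\<theta>\<close> on the circle, where \<open>d\<theta>\<close> is Lebesgue measure on a fundamental domain.\<close>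

definition OA_measure :: "real \<Rightarrow> real \<Rightarrow> torus measure" where
  "OA_measure \<alpha> \<beta> =
     distr (density lborel (\<lambda>\<theta>. ennreal (OA_density \<alpha> \<beta> \<theta>) * indicator {- pi..<pi} \<theta>)) borel to_torus"

definition OA_dynamics :: "real \<Rightarrow> (real \<Rightarrow> real) \<Rightarrow> (real \<Rightarrow> real) \<Rightarrow> bool" where
  "OA_dynamics K \<alpha> \<beta> \<longleftrightarrow> (\<forall>t\<ge>0.
     (\<beta> has_real_derivative K / 2 * \<beta> t * (1 - (\<beta> t)\<^sup>2)) (at t within {0..}) \<and>
     (\<alpha> has_real_derivative 0) (at t within {0..}))"


section \<open>Parametrization of the unstable manifolds\<close>

text \<open>
  With \<open>u = \<pi> \<xi> + A\<close>, the integer \<open>k\<close> such that \<open>u \<in> [\<pi> (k - 1/2), \<pi> (k + 1/2)]\<close> is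
  \<open>round (u / \<pi>)\<close>, uniquely so unless \<open>cos u = 0\<close>. At \<open>u = \<pi> (k + 1/2)\<close> the arctangent term tends to
  \<open>\<pi>\<close> from the left, and to \<open>- \<pi>\<close> from the right where \<open>k\<close> has become \<open>k + 1\<close>; so the continuous
  extension has the value \<open>\<pi> (2 k + 1) - \<alpha> = 2 u - \<alpha>\<close>.
\<close>

definition phi :: "real \<Rightarrow> real \<Rightarrow> real \<Rightarrow> real \<Rightarrow> real" where
  "phi \<alpha> \<beta> A \<xi> = (let u = pi * \<xi> + A in
     if cos u = 0 then 2 * u - \<alpha>
     else 2 * arctan ((1 - \<beta>) / (1 + \<beta>) * tan u) - \<alpha> + 2 * pi * of_int (round (u / pi)))"

definition phi_i :: "nat \<Rightarrow> real \<Rightarrow> real \<Rightarrow> real \<Rightarrow> nat \<Rightarrow> real" where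
  "phi_i N \<alpha> \<beta> A i = phi \<alpha> \<beta> A ((2 * real i - 1) / (2 * real N))"

definition theta :: "nat \<Rightarrow> real \<Rightarrow> real \<Rightarrow> real \<Rightarrow> nat \<Rightarrow> torus" where
  "theta N \<alpha> \<beta> A i = to_torus (phi_i N \<alpha> \<beta> A i)"

text \<open>
  The parameters \<open>(\<alpha>, \<beta>, A)\<close> whose points \<^term>\<open>theta N \<alpha> \<beta> A\<close> make up the unstable manifold
  \<open>W\<^sup>u(\<theta>\<^sup>N\<^sub>q)\<close> of the Kuramoto model.
\<close>

definition Wu_params :: "nat \<Rightarrow> torus \<Rightarrow> (real \<times> real \<times> real) set" where
  "Wu_params N q = {(\<alpha>, \<beta>, A). \<beta> \<in> {0..<1} \<and> \<alpha> \<in> {- pi..pi} \<and> A \<in> {- (pi / 2)..pi / 2} \<and>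
     to_torus (1 / real N * (\<Sum>i=1..N. phi_i N \<alpha> \<beta> A i)) = q}"

lemma phi_branch:
  fixes k :: int
  assumes "pi * \<xi> + A \<in> {pi * (k - 1/2)<..<pi * (k + 1/2)}"
  shows "phi \<alpha> \<beta> A \<xi> = 2 * arctan ((1 - \<beta>) / (1 + \<beta>) * tan (pi * \<xi> + A)) - \<alpha> + 2 * pi * k"
proof -
  define u where "u = pi * \<xi> + A"
  have u: "k - 1/2 < u / pi" "u / pi < k + 1/2"
    using assms by (simp_all add: u_def field_simps)
  then have "round (u / pi) = k" by (simp add: round_unique)
  moreover have "cos u \<noteq> 0"
  proof
    assume "cos u = 0"
    then obtain i where "odd i" "u = of_int i * (pi / 2)" using cos_zero_iff_int by blast
    then obtain j :: int where "u / pi = j + 1/2" by (auto simp: field_simps elim!: oddE)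
    with u have "of_int k < (of_int (j + 1) :: real)" "of_int j < (of_int k :: real)" by simp_all
    then have "k < j + 1" "j < k" by (simp_all only: of_int_less_iff)
    then show False by simp
  qed
  ultimately show ?thesis by (simp add: phi_def u_def Let_def)
qed


section \<open>The reduced dynamics on the unstable manifolds\<close>

definition B_coef :: "nat \<Rightarrow> real \<Rightarrow> real \<Rightarrow> real" where
  "B_coef N A \<beta> =
     (1 + \<beta> ^ (2 * N - 2) + cos (2 * A * real N) * (- \<beta>) ^ (N - 2) * (1 + \<beta>\<^sup>2)) /
     (1 + \<beta> ^ (2 * N) + 2 * (- \<beta>) ^ N * cos (2 * A * real N))"

definition D_coef :: "nat \<Rightarrow> real \<Rightarrow> real \<Rightarrow> real" where
  "D_coef N A \<beta> =
     (sin (2 * A * real N) * (- \<beta>) ^ (N - 2) * (\<beta>\<^sup>2 - 1)) /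
     (1 + \<beta> ^ (2 * N) + 2 * (- \<beta>) ^ N * cos (2 * A * real N))"

definition Wu_dynamics ::
    "real \<Rightarrow> nat \<Rightarrow> (real \<Rightarrow> real) \<Rightarrow> (real \<Rightarrow> real) \<Rightarrow> (real \<Rightarrow> real) \<Rightarrow> bool" where
  "Wu_dynamics K N \<alpha> \<beta> A \<longleftrightarrow> (\<forall>t\<ge>0.
     (\<beta> has_real_derivative K / 2 * \<beta> t * (1 - (\<beta> t)\<^sup>2) * B_coef N (A t) (\<beta> t)) (at t within {0..}) \<and>
     (\<alpha> has_real_derivative K / 2 * (1 + (\<beta> t)\<^sup>2) * D_coef N (A t) (\<beta> t)) (at t within {0..}) \<and>
     (A has_real_derivative K / 4 * (1 - (\<beta> t)\<^sup>2) * D_coef N (A t) (\<beta> t)) (at t within {0..}))"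

end

theory Submission
  imports Defs "HOL-Real_Asymp.Real_Asymp"
begin

text \<open>
  For every \<open>A\<close> the measure \<open>f\<^sub>\<alpha>\<^sub>,\<^sub>\<beta>\<close> is the image of the uniform measure on \<open>[0, 1)\<close> under
  \<open>\<xi> \<mapsto> \<phi>(\<alpha>, \<beta>, A, \<xi>)\<close>, while the empirical measure is its image under the sampling of \<open>\<phi>\<close> at the
  midpoints of \<open>N\<close> cells. Coupling the two through the same \<open>\<xi>\<close> and the same \<open>A\<close> bounds the transport
  cost by the sampling error of the monotone function \<open>\<phi>\<close>, which is at most \<open>2\<pi> / N\<close> in the mean
  uniformly in all parameters, plus \<open>\<bar>\<alpha>\<^sub>N - \<alpha>\<bar>\<close>, plus a modulus of continuity in \<open>\<beta>\<close> valid up to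
  \<open>\<beta> = 1\<close>. So it suffices that \<open>\<alpha>\<^sub>N\<close> and \<open>\<beta>\<^sub>N\<close> converge uniformly in time.

  Both \<open>\<bar>B\<^sub>N - 1\<bar>\<close> and \<open>\<bar>D\<^sub>N\<bar>\<close> are at most \<open>min (2 / (N - 1)) \<beta>\<close>. If \<open>\<beta>(0) > 0\<close>, the quantity
  \<open>v = (1 - \<beta>\<^sup>2) / \<beta>\<^sup>2\<close> satisfies \<open>v' = - K B\<^sub>N v\<close>, which compares \<open>\<beta>\<^sub>N\<close> with \<open>\<beta>\<close> for all times, and the
  variation of \<open>A\<^sub>N\<close> is dominated by that of \<open>\<beta>\<^sub>N / (N \<beta>\<^sub>N(0))\<close>. The bound on \<open>D\<^sub>N\<close> is not integrable in
  time and does not control \<open>\<alpha>\<^sub>N\<close>; instead, conservation of the mean phase expresses \<open>\<alpha>\<^sub>N\<close> through \<open>A\<^sub>N\<close>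
  up to \<open>O(1 / N)\<close>. If \<open>\<beta>(0) = 0\<close>, then \<open>\<beta>\<^sub>N\<close> and the drift of \<open>\<alpha>\<^sub>N\<close> are at most \<open>\<beta>\<^sub>N(0) e\<^sup>K\<^sup>t\<close>.
\<close>

section \<open>The circle and uniform sampling\<close>

text \<open>The bounded diameter later reduces the \<open>p\<close>-th power of the distance to the
  distance itself and justifies truncating error terms at \<open>pi\<close>.\<close>

lemma dist_torus_le_pi: "dist (x::torus) y \<le> pi"
proof -
  have "arc_length z \<le> pi" for z
  proof -
    define k where "k = round (z / (2 * pi))"
    have "\<bar>z / (2 * pi) - of_int k\<bar> \<le> 1 / 2"
      unfolding k_def using of_int_round_abs_le[of "z / (2*pi)"] by (simp add: abs_minus_commute)
    then have "\<bar>z + 2 * pi * of_int (- k)\<bar> \<le> pi"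
      by (simp add: abs_le_iff field_simps)
    then show ?thesis using arc_length_le[of z "- k"] by linarith
  qed
  then show ?thesis by transfer
qed

section \<open>Integrals of periodic functions over one period\<close>

lemma nn_set_integral_translate:
  fixes h :: "real \<Rightarrow> ennreal"
  assumes [measurable]: "h \<in> borel_measurable borel" and per: "\<And>x. h (x + P) = h x"
  shows "(\<integral>\<^sup>+x\<in>{a + P..<b + P}. h x \<partial>lborel) = (\<integral>\<^sup>+x\<in>{a..<b}. h x \<partial>lborel)"
proof -
  have "(\<integral>\<^sup>+x\<in>{a + P..<b + P}. h x \<partial>lborel)
      = (\<integral>\<^sup>+x. h (P + 1 * x) * indicator {a + P..<b + P} (P + 1 * x) \<partial>lborel)"
    by (subst nn_integral_real_affine[where c = 1 and t = P]) auto
  also have "\<dots> = (\<integral>\<^sup>+x\<in>{a..<b}. h x \<partial>lborel)"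
    by (intro nn_integral_cong) (auto simp: indicator_def per add.commute[of P])
  finally show ?thesis .
qed

lemma nn_set_integral_Un_interval:
  fixes h :: "real \<Rightarrow> ennreal" and a b c :: real
  assumes [measurable]: "h \<in> borel_measurable borel" and "a \<le> b" "b \<le> c"
  shows "(\<integral>\<^sup>+x\<in>{a..<c}. h x \<partial>lborel)
    = (\<integral>\<^sup>+x\<in>{a..<b}. h x \<partial>lborel) + (\<integral>\<^sup>+x\<in>{b..<c}. h x \<partial>lborel)"
proof -
  have "{a..<c} = {a..<b} \<union> {b..<c}" "{a..<b} \<inter> {b..<c} = {}" using assms by auto
  then show ?thesis
    by (subst nn_integral_add[symmetric]) (auto intro!: nn_integral_cong simp: indicator_def)
qed

text \<open>Moving the window right by at most one period cuts off a piece on the left whose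
  translate is glued on at the right. Iterating this reaches every window.\<close>

lemma nn_integral_over_period:
  fixes h :: "real \<Rightarrow> ennreal"
  assumes h: "h \<in> borel_measurable borel" and P: "P > 0" and per: "\<And>x. h (x + P) = h x"
  shows "(\<integral>\<^sup>+x\<in>{a..<a + P}. h x \<partial>lborel) = (\<integral>\<^sup>+x\<in>{b..<b + P}. h x \<partial>lborel)"
proof -
  define J where "J a = (\<integral>\<^sup>+x\<in>{a..<a + P}. h x \<partial>lborel)" for a
  have step: "J a = J b" if "a \<le> b" "b \<le> a + P" for a b
  proof -
    have "J a = (\<integral>\<^sup>+x\<in>{a..<b}. h x \<partial>lborel) + (\<integral>\<^sup>+x\<in>{b..<a + P}. h x \<partial>lborel)"
      unfolding J_def using that by (intro nn_set_integral_Un_interval h) auto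
    also have "\<dots> = (\<integral>\<^sup>+x\<in>{b..<a + P}. h x \<partial>lborel) + (\<integral>\<^sup>+x\<in>{a + P..<b + P}. h x \<partial>lborel)"
      using nn_set_integral_translate[OF h per, of a b] by (simp add: add.commute)
    also have "\<dots> = J b"
      unfolding J_def using that by (intro nn_set_integral_Un_interval[symmetric] h) auto
    finally show ?thesis .
  qed
  have far: "J a = J b" if "a \<le> b" "b \<le> a + real n * P" for a b and n :: nat
    using that
  proof (induction n arbitrary: b)
    case (Suc n)
    show ?case
    proof (cases "b \<le> a + real n * P")
      case False
      \<comment> \<open>The intermediate point is at most \<open>n\<close> periods after
        \<open>a\<close> and at most one period before \<open>b\<close>.\<close>
      have "J a = J (max a (b - P))" using Suc.prems P by (intro Suc.IH) (auto simp: algebra_simps)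
      also have "\<dots> = J b" using Suc.prems P by (intro step) auto
      finally show ?thesis .
    qed (use Suc in auto)
  qed auto
  have le: "J a = J b" if "a \<le> b" for a b
  proof -
    obtain n :: nat where "(b - a) / P < real n" using reals_Archimedean2 by blast
    then show ?thesis using P that by (intro far[of _ _ n]) (auto simp: field_simps)
  qed
  have "J a = J b" using le[of a b] le[of b a] by (metis linear)
  then show ?thesis unfolding J_def .
qed

section \<open>The uniform law on the unit interval and its sampling on \<open>N\<close>
  cells\<close>

definition unif01 :: "real measure" where
  "unif01 = density lborel (indicator {0..<1})"

lemma space_unif01 [simp]: "space unif01 = UNIV"
  and sets_unif01 [simp, measurable_cong]: "sets unif01 = sets borel"
  by (simp_all add: unif01_def)

lemma nn_integral_unif01:
  "f \<in> borel_measurable borel \<Longrightarrow> nn_integral unif01 f = (\<integral>\<^sup>+x\<in>{0..<1}. f x \<partial>lborel)"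
  by (simp add: unif01_def nn_integral_density mult.commute)

lemma prob_space_unif01: "prob_space unif01"
  by standard (simp add: unif01_def emeasure_density)

lemma emeasure_distr_unif01:
  assumes "f \<in> borel_measurable borel" and "E \<in> sets borel"
  shows "emeasure (distr unif01 borel f) E = (\<integral>\<^sup>+x\<in>{0..<1}. indicator E (f x) \<partial>lborel)"
proof -
  have [measurable]: "f \<in> borel_measurable borel" "E \<in> sets borel" by fact+
  have "emeasure (distr unif01 borel f) E = (\<integral>\<^sup>+y. indicator E y \<partial>distr unif01 borel f)"
    by simp
  also have "\<dots> = (\<integral>\<^sup>+x. indicator E (f x) \<partial>unif01)"
    by (rule nn_integral_distr) auto
  finally show ?thesis by (simp add: nn_integral_unif01)
qed

text \<open>Cells are half-open and counted from \<open>1\<close>, to match the index set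
  \<open>{1..N}\<close> of the empirical measure.\<close>

definition cell :: "nat \<Rightarrow> real \<Rightarrow> nat" where
  "cell N \<xi> = nat \<lfloor>real N * \<xi>\<rfloor> + 1"

lemma measurable_cell [measurable]: "cell N \<in> measurable borel (count_space UNIV)"
  unfolding cell_def by measurable

lemma cell_eq_iff:
  assumes "\<xi> \<ge> 0" "N > 0" "i \<ge> 1"
  shows "cell N \<xi> = i \<longleftrightarrow> \<xi> \<in> {(real i - 1) / real N..<real i / real N}"
proof -
  have "cell N \<xi> = i \<longleftrightarrow> \<lfloor>real N * \<xi>\<rfloor> = int i - 1"
    using assms by (auto simp: cell_def nat_eq_iff)
  also have "\<dots> \<longleftrightarrow> real i - 1 \<le> real N * \<xi> \<and> real N * \<xi> < real i"
    by (auto simp: floor_eq_iff)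
  finally show ?thesis using assms by (auto simp: field_simps)
qed

lemma cell_in: "0 \<le> \<xi> \<Longrightarrow> \<xi> < 1 \<Longrightarrow> N > 0 \<Longrightarrow> cell N \<xi> \<in> {1..N}"
proof -
  assume a: "0 \<le> \<xi>" "\<xi> < 1" "N > 0"
  then have "real N * \<xi> < real N" by simp
  then have "\<lfloor>real N * \<xi>\<rfloor> < int N" by (simp add: floor_less_iff)
  then show ?thesis using a by (auto simp: cell_def)
qed

text \<open>Each index in \<open>{1..N}\<close> is attained on an interval of length
  \<open>1 / N\<close>, so the integral is an average over indices.\<close>

lemma nn_integral_cells:
  fixes f :: "nat \<Rightarrow> ennreal"
  assumes N: "N > 0"
  shows "(\<integral>\<^sup>+\<xi>\<in>{0..<1}. f (cell N \<xi>) \<partial>lborel) = ennreal (1 / real N) * (\<Sum>i=1..N. f i)"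
proof -
  have "f (cell N \<xi>) * indicator {0..<1} \<xi>
      = (\<Sum>i=1..N. f i * indicator {(real i - 1) / real N..<real i / real N} \<xi>)" for \<xi>
  proof (cases "\<xi> \<in> {0..<1}")
    case True
    have "(\<Sum>i=1..N. f i * indicator {(real i - 1) / real N..<real i / real N} \<xi>)
        = (\<Sum>i=1..N. if i = cell N \<xi> then f i else 0)"
      using True N cell_eq_iff[of \<xi> N] by (intro sum.cong) (auto simp: indicator_def)
    then show ?thesis using True cell_in[of \<xi> N] N by simp
  next
    case False
    have "\<xi> \<notin> {(real i - 1) / real N..<real i / real N}" if "i \<in> {1..N}" for i
    proof
      assume "\<xi> \<in> {(real i - 1) / real N..<real i / real N}"
      moreover have "0 \<le> (real i - 1) / real N" "real i / real N \<le> 1"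
        using that N by auto
      ultimately show False using False by auto
    qed
    then show ?thesis using False by simp
  qed
  then have "(\<integral>\<^sup>+\<xi>\<in>{0..<1}. f (cell N \<xi>) \<partial>lborel)
      = (\<integral>\<^sup>+\<xi>. (\<Sum>i=1..N. f i * indicator {(real i - 1) / real N..<real i / real N} \<xi>) \<partial>lborel)"
    by (intro nn_integral_cong) simp
  also have "\<dots> = (\<Sum>i=1..N. \<integral>\<^sup>+\<xi>. f i * indicator {(real i - 1) / real N..<real i / real N} \<xi> \<partial>lborel)"
    by (intro nn_integral_sum) auto
  also have "\<dots> = (\<Sum>i=1..N. f i * ennreal (real i / real N - (real i - 1) / real N))"
    by (intro sum.cong) (simp_all add: nn_integral_cmult_indicator divide_right_mono)
  also have "\<dots> = (\<Sum>i=1..N. ennreal (1 / real N) * f i)"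
    by (intro sum.cong) (auto simp: diff_divide_distrib[symmetric] mult.commute)
  finally show ?thesis by (simp add: sum_distrib_left)
qed

lemma empirical_measure_eq_distr:
  assumes N: "N > 0"
  shows "distr unif01 borel (\<lambda>\<xi>. x (cell N \<xi>)) = empirical_measure N x"
proof (rule measure_eqI)
  fix E assume "E \<in> sets (distr unif01 borel (\<lambda>\<xi>. x (cell N \<xi>)))"
  then have E: "E \<in> sets borel" by simp
  have "emeasure (distr unif01 borel (\<lambda>\<xi>. x (cell N \<xi>))) E
      = (\<integral>\<^sup>+\<xi>\<in>{0..<1}. indicator E (x (cell N \<xi>)) \<partial>lborel)"
    using E by (intro emeasure_distr_unif01) auto
  also have "\<dots> = emeasure (empirical_measure N x) E"
    using E nn_integral_cells[OF N, of "\<lambda>i. indicator E (x i)"]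
    by (simp add: emeasure_empirical_measure)
  finally show "emeasure (distr unif01 borel (\<lambda>\<xi>. x (cell N \<xi>))) E
      = emeasure (empirical_measure N x) E" .
qed (simp add: sets_empirical_measure)

section \<open>The parametrization as a lift of a Moebius map\<close>

lemma one_plus_cos_pos:
  fixes \<beta> x :: real assumes "0 \<le> \<beta>" "\<beta> < 1" shows "0 < 1 + \<beta> * cos x"
proof -
  have "\<bar>\<beta> * cos x\<bar> \<le> \<beta> * 1" unfolding abs_mult using assms by (intro mult_mono) auto
  then show ?thesis using assms by linarith
qed

lemma poisson_den_pos:
  fixes \<beta> x :: real assumes "0 \<le> \<beta>" "\<beta> < 1" shows "0 < 1 + 2 * \<beta> * cos x + \<beta>\<^sup>2"
proof -
  \<comment> \<open>The right-hand side is the squared modulus of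
    \<open>1 + \<beta> e^(ix)\<close>.\<close>
  have "1 + 2 * \<beta> * cos x + \<beta>\<^sup>2 = (1 + \<beta> * cos x)\<^sup>2 + (\<beta> * sin x)\<^sup>2"
    using sin_cos_squared_add[of x] by algebra
  then show ?thesis using one_plus_cos_pos[OF assms, of x] by (simp add: add_pos_nonneg)
qed

text \<open>With \<open>w = e\<^sup>2\<^sup>i\<^sup>u\<close>, this is a continuous argument of \<open>(w + \<beta>) / (1 + \<beta> w)\<close>.\<close>

definition moebius_lift :: "real \<Rightarrow> real \<Rightarrow> real" where
  "moebius_lift \<beta> u = 2 * u - 2 * arctan (\<beta> * sin (2 * u) / (1 + \<beta> * cos (2 * u)))"

text \<open>Half of either side is an angle in the open interval from \<open>- pi / 2\<close> to
  \<open>pi / 2\<close>, so it suffices to compare tangents by the subtraction formula.\<close>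

lemma arctan_eq_moebius_lift:
  assumes "cos v \<noteq> 0" "\<bar>v\<bar> < pi / 2" "0 \<le> \<beta>" "\<beta> < 1"
  shows "2 * arctan ((1 - \<beta>) / (1 + \<beta>) * tan v) = moebius_lift \<beta> v"
proof -
  define q where "q = \<beta> * sin (2 * v) / (1 + \<beta> * cos (2 * v))"
  have pos: "0 < 1 + \<beta> * cos (2 * v)" using assms by (intro one_plus_cos_pos)
  have cv: "0 < cos v" using assms by (intro cos_gt_zero_pi) auto
  have bnd: "- (pi/2) < arctan q" "arctan q < pi/2"
    using arctan_bounded[of q] by auto
  \<comment> \<open>The angles \<open>v\<close> and \<open>arctan q\<close> have the same sign, so
    their difference is no larger than the larger of the two.\<close>
  have range: "\<bar>v - arctan q\<bar> < pi / 2"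
  proof (cases "v \<ge> 0")
    case True
    then have "0 \<le> sin (2 * v)" using assms by (intro sin_ge_zero) auto
    then have "0 \<le> q" unfolding q_def using pos assms by simp
    then have "0 \<le> arctan q" by simp
    then show ?thesis using True assms bnd by linarith
  next
    case False
    then have "0 \<le> sin (2 * (- v))" using assms by (intro sin_ge_zero) auto
    then have "q \<le> 0" unfolding q_def using pos assms by (simp add: divide_nonpos_pos mult_nonneg_nonpos)
    then have "arctan q \<le> 0" by simp
    then show ?thesis using False assms bnd by linarith
  qed
  have "tan (v - arctan q) = (tan v - q) / (1 + tan v * q)"
  proof -
    have "cos (arctan q) \<noteq> 0" by simp
    moreover have "cos (v - arctan q) > 0" using range by (intro cos_gt_zero_pi) linarith+
    ultimately show ?thesis using assms(1) tan_diff[of v "arctan q"] by (simp add: tan_arctan)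
  qed
  also have "\<dots> = (1 - \<beta>) / (1 + \<beta>) * tan v"
  proof -
    define s c where "s = sin v" and "c = cos v"
    have sc: "s * s = 1 - c * c" using sin_cos_squared_add[of v] unfolding s_def c_def
      by (simp add: power2_eq_square)
    have q: "q = \<beta> * (2 * s * c) / (1 + \<beta> * (2 * c * c - 1))"
      unfolding q_def s_def c_def by (simp add: sin_double cos_double_cos power2_eq_square mult.assoc)
    have den: "1 + \<beta> * (2 * c * c - 1) > 0"
      using pos unfolding c_def by (simp add: cos_double_cos power2_eq_square mult.assoc)
    have c0: "c \<noteq> 0" using cv unfolding c_def by simp
    have t: "tan v = s / c" by (simp add: tan_def s_def c_def)
    have 1: "tan v - q = s * (1 - \<beta>) / (c * (1 + \<beta> * (2 * c * c - 1)))"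
    proof -
      have "tan v - q = (s * (1 + \<beta> * (2 * c * c - 1)) - \<beta> * (2 * s * c) * c) / (c * (1 + \<beta> * (2 * c * c - 1)))"
        unfolding t q using den c0 by (intro diff_frac_eq) auto
      also have "s * (1 + \<beta> * (2 * c * c - 1)) - \<beta> * (2 * s * c) * c = s * (1 - \<beta>)"
        by (simp add: algebra_simps)
      finally show ?thesis .
    qed
    have 2: "1 + tan v * q = (1 + \<beta>) / (1 + \<beta> * (2 * c * c - 1))"
    proof -
      have "tan v * q = \<beta> * 2 * (s * s) / (1 + \<beta> * (2 * c * c - 1))"
        unfolding t q using c0 by (simp add: mult_ac)
      then show ?thesis unfolding sc using den by (simp add: field_simps)
    qed
    show ?thesis unfolding 1 2 unfolding t using den c0 assms by (simp add: mult.commute)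
  qed
  finally have tan: "tan (v - arctan q) = (1 - \<beta>) / (1 + \<beta>) * tan v" .
  have "arctan (tan (v - arctan q)) = v - arctan q" using range by (intro arctan_tan) linarith+
  then have "arctan ((1 - \<beta>) / (1 + \<beta>) * tan v) = v - arctan q" unfolding tan .
  then show ?thesis unfolding moebius_lift_def q_def[symmetric] by simp
qed

text \<open>The arctangent correction has period \<open>pi\<close> in \<open>u\<close>; only the
  term \<open>2 * u\<close> sees the shift.\<close>

lemma moebius_lift_add_pi: "moebius_lift \<beta> (u + of_int k * pi) = moebius_lift \<beta> u + 2 * pi * of_int k"
proof -
  have "2 * (u + of_int k * pi) = 2 * u + 2 * pi * of_int k" by (simp add: algebra_simps)
  moreover have "sin (2 * u + 2 * pi * of_int k) = sin (2 * u)" "cos (2 * u + 2 * pi * of_int k) = cos (2 * u)"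
    by (simp_all add: sin_add cos_add)
  ultimately show ?thesis by (simp only: moebius_lift_def)
qed

text \<open>Rounding gives the non-strict bound, and equality would force the cosine to vanish. This
  puts the reduced angle where \<open>arctan_eq_moebius_lift\<close> applies.\<close>

lemma abs_minus_round_times_pi_less:
  fixes u :: real
  assumes "cos u \<noteq> 0"
  shows "\<bar>u - of_int (round (u / pi)) * pi\<bar> < pi / 2"
proof -
  define k where "k = round (u / pi)"
  have "\<bar>u / pi - of_int k\<bar> \<le> 1 / 2"
    unfolding k_def using of_int_round_abs_le[of "u / pi"] by (simp add: abs_minus_commute)
  moreover have "\<bar>u / pi - of_int k\<bar> \<noteq> 1 / 2"
  proof
    assume "\<bar>u / pi - of_int k\<bar> = 1 / 2"
    then have "u / pi - of_int k = 1 / 2 \<or> u / pi - of_int k = - 1 / 2" by linarith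
    then have "u = pi / 2 + of_int k * pi \<or> u = - (pi / 2) + of_int k * pi"
      by (auto simp: field_simps)
    then have "cos u = 0"
      by (auto simp: cos_add sin_zero_iff_int2 sin_diff cos_diff mult.commute)
    with assms show False by simp
  qed
  ultimately have "\<bar>u / pi - of_int k\<bar> < 1 / 2" by linarith
  then show ?thesis unfolding k_def[symmetric] by (simp add: abs_less_iff field_simps)
qed

text \<open>The rounding term of \<open>phi\<close> matches the quasi-periodicity of the lift. Where
  \<open>cos u = 0\<close>, also \<open>sin (2 * u) = 0\<close>, so the extended value fits as well.
  A definition by cases thus becomes one smooth formula.\<close>

lemma phi_eq_moebius_lift:
  assumes "0 \<le> \<beta>" "\<beta> < 1"
  shows "phi \<alpha> \<beta> A \<xi> = moebius_lift \<beta> (pi * \<xi> + A) - \<alpha>"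
proof -
  define u where "u = pi * \<xi> + A"
  show ?thesis
  proof (cases "cos u = 0")
    case True
    then have "moebius_lift \<beta> u = 2 * u" by (simp add: moebius_lift_def sin_double)
    then show ?thesis using True by (simp add: phi_def u_def Let_def)
  next
    case False
    define k where "k = round (u / pi)"
    define v where "v = u - of_int k * pi"
    have uv: "u = v + of_int k * pi" by (simp add: v_def)
    have v: "\<bar>v\<bar> < pi / 2" unfolding v_def k_def using False by (rule abs_minus_round_times_pi_less)
    then have cv: "cos v \<noteq> 0" using cos_gt_zero_pi[of v] by linarith
    have "tan u = tan v" unfolding uv by (rule tan_periodic_int)
    then have "phi \<alpha> \<beta> A \<xi> = moebius_lift \<beta> v + 2 * pi * of_int k - \<alpha>"
      using False arctan_eq_moebius_lift[OF cv v assms] by (simp add: phi_def u_def[symmetric] Let_def k_def)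
    also have "moebius_lift \<beta> v + 2 * pi * of_int k = moebius_lift \<beta> u"
      unfolding uv moebius_lift_add_pi ..
    finally show ?thesis by (simp add: u_def)
  qed
qed

text \<open>With \<open>w = e^(2iu)\<close> the correction term is twice the argument of
  \<open>1 + \<beta> w\<close>, whose tangent is \<open>q\<close> in the proof. The speed is twice a
  Poisson kernel, with denominator the squared modulus of \<open>1 + \<beta> w\<close>.\<close>

lemma moebius_lift_has_derivative:
  assumes "0 \<le> \<beta>" "\<beta> < 1"
  shows "(moebius_lift \<beta> has_real_derivative 2 * (1 - \<beta>\<^sup>2) / (1 + 2 * \<beta> * cos (2 * u) + \<beta>\<^sup>2)) (at u)"
proof -
  define s c where "s = sin (2 * u)" and "c = cos (2 * u)"
  have sc: "s * s = 1 - c * c" using sin_cos_squared_add[of "2 * u"] unfolding s_def c_def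
      by (simp add: power2_eq_square)
  have pos: "0 < 1 + \<beta> * c" unfolding c_def using assms by (rule one_plus_cos_pos)
  have den: "0 < 1 + 2 * \<beta> * c + \<beta>\<^sup>2" unfolding c_def using assms by (rule poisson_den_pos)
  define q where "q = \<beta> * s / (1 + \<beta> * c)"
  define q' where "q' = (\<beta> * (2 * c) * (1 + \<beta> * c) - \<beta> * s * (\<beta> * - (2 * s))) / (1 + \<beta> * c)\<^sup>2"
  have "((\<lambda>u. \<beta> * sin (2 * u) / (1 + \<beta> * cos (2 * u))) has_real_derivative q') (at u)"
    using pos unfolding q'_def s_def c_def
    by (auto intro!: derivative_eq_intros simp: power2_eq_square)
  note d = DERIV_chain2[OF DERIV_arctan this]
  have "(moebius_lift \<beta> has_real_derivative 2 * 1 - 2 * (inverse (1 + q\<^sup>2) * q')) (at u)"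
    unfolding moebius_lift_def [abs_def] q_def s_def c_def
    by (intro DERIV_diff DERIV_cmult DERIV_ident d)
  then have "(moebius_lift \<beta> has_real_derivative 2 - 2 * (q' / (1 + q\<^sup>2))) (at u)"
    by (simp add: divide_inverse mult.commute)
  moreover have "2 - 2 * (q' / (1 + q\<^sup>2)) = 2 * (1 - \<beta>\<^sup>2) / (1 + 2 * \<beta> * c + \<beta>\<^sup>2)"
  proof -
    have "1 + q\<^sup>2 = ((1 + \<beta> * c)\<^sup>2 + \<beta>\<^sup>2 * (s * s)) / (1 + \<beta> * c)\<^sup>2"
      unfolding q_def using pos by (simp add: power_divide power_mult_distrib add_divide_distrib power2_eq_square)
    also have "(1 + \<beta> * c)\<^sup>2 + \<beta>\<^sup>2 * (s * s) = 1 + 2 * \<beta> * c + \<beta>\<^sup>2"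
      unfolding sc by (simp add: field_simps power2_eq_square)
    finally have a: "1 + q\<^sup>2 = (1 + 2 * \<beta> * c + \<beta>\<^sup>2) / (1 + \<beta> * c)\<^sup>2" .
    have "\<beta> * (2 * c) * (1 + \<beta> * c) - \<beta> * s * (\<beta> * - (2 * s)) = 2 * \<beta> * c + 2 * \<beta>\<^sup>2 * (c * c) + 2 * \<beta>\<^sup>2 * (s * s)"
      by (simp add: algebra_simps power2_eq_square)
    also have "\<dots> = 2 * \<beta> * c + 2 * \<beta>\<^sup>2" unfolding sc by (simp add: algebra_simps)
    finally have "q' = (2 * \<beta> * c + 2 * \<beta>\<^sup>2) / (1 + \<beta> * c)\<^sup>2" unfolding q'_def by simp
    then have "q' / (1 + q\<^sup>2) = (2 * \<beta> * c + 2 * \<beta>\<^sup>2) / (1 + 2 * \<beta> * c + \<beta>\<^sup>2)"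
      unfolding a using pos by simp
    then have "2 - 2 * (q' / (1 + q\<^sup>2))
        = (2 * (1 + 2 * \<beta> * c + \<beta>\<^sup>2) - 2 * (2 * \<beta> * c + 2 * \<beta>\<^sup>2)) / (1 + 2 * \<beta> * c + \<beta>\<^sup>2)"
      using den by (simp only: diff_divide_distrib times_divide_eq_right nonzero_mult_div_cancel_right less_imp_neq[symmetric] simp_thms)
    also have "2 * (1 + 2 * \<beta> * c + \<beta>\<^sup>2) - 2 * (2 * \<beta> * c + 2 * \<beta>\<^sup>2) = 2 * (1 - \<beta>\<^sup>2)"
      by (simp add: algebra_simps)
    finally show ?thesis .
  qed
  ultimately show ?thesis by (simp add: c_def)
qed

text \<open>This is the real part of \<open>(w + \<beta>) / (1 + \<beta> w)\<close> for
  \<open>w = e^(2iu)\<close>, obtained from the double-angle formulas in terms of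
  \<open>q\<close>.\<close>

lemma cos_moebius_lift:
  assumes "0 \<le> \<beta>" "\<beta> < 1"
  shows "cos (moebius_lift \<beta> u) = ((1 + \<beta>\<^sup>2) * cos (2 * u) + 2 * \<beta>) / (1 + 2 * \<beta> * cos (2 * u) + \<beta>\<^sup>2)"
proof -
  define s c where "s = sin (2 * u)" and "c = cos (2 * u)"
  have sc: "s * s = 1 - c * c" using sin_cos_squared_add[of "2 * u"] unfolding s_def c_def
      by (simp add: power2_eq_square)
  have pos: "0 < 1 + \<beta> * c" unfolding c_def using assms by (rule one_plus_cos_pos)
  have den: "0 < 1 + 2 * \<beta> * c + \<beta>\<^sup>2" unfolding c_def using assms by (rule poisson_den_pos)
  define q where "q = \<beta> * s / (1 + \<beta> * c)"
  have "1 + q\<^sup>2 = ((1 + \<beta> * c)\<^sup>2 + \<beta>\<^sup>2 * (s * s)) / (1 + \<beta> * c)\<^sup>2"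
    unfolding q_def using pos by (simp add: power_divide power_mult_distrib add_divide_distrib power2_eq_square)
  also have "(1 + \<beta> * c)\<^sup>2 + \<beta>\<^sup>2 * (s * s) = 1 + 2 * \<beta> * c + \<beta>\<^sup>2"
    unfolding sc by (simp add: field_simps power2_eq_square)
  finally have a: "1 + q\<^sup>2 = (1 + 2 * \<beta> * c + \<beta>\<^sup>2) / (1 + \<beta> * c)\<^sup>2" .
  have q1: "1 + q\<^sup>2 > 0" by (simp add: add_pos_nonneg)
  have sq: "(sqrt (1 + q\<^sup>2))\<^sup>2 = 1 + q\<^sup>2" by simp
  have cc: "cos (2 * arctan q) = (1 - q\<^sup>2) / (1 + q\<^sup>2)"
    using q1 by (simp add: cos_double cos_arctan sin_arctan power_divide diff_divide_distrib)
  have ss: "sin (2 * arctan q) = 2 * q / (1 + q\<^sup>2)"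
    using q1 sq by (simp add: sin_double cos_arctan sin_arctan power2_eq_square)
  have "cos (moebius_lift \<beta> u) = (c * (1 - q\<^sup>2) + s * (2 * q)) / (1 + q\<^sup>2)"
    unfolding moebius_lift_def cos_diff s_def[symmetric] c_def[symmetric] q_def[symmetric] cc ss
    by (simp add: add_divide_distrib)
  also have "c * (1 - q\<^sup>2) + s * (2 * q) = (c * ((1 + \<beta> * c)\<^sup>2 - \<beta>\<^sup>2 * (s * s)) + 2 * \<beta> * (s * s) * (1 + \<beta> * c)) / (1 + \<beta> * c)\<^sup>2"
  proof -
    define r where "r = 1 + \<beta> * c"
    have "r \<noteq> 0" using pos by (simp add: r_def)
    then show ?thesis unfolding q_def r_def[symmetric]
      by (simp add: power2_eq_square field_simps)
  qed
  also have "c * ((1 + \<beta> * c)\<^sup>2 - \<beta>\<^sup>2 * (s * s)) + 2 * \<beta> * (s * s) * (1 + \<beta> * c) = (1 + \<beta>\<^sup>2) * c + 2 * \<beta>"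
    unfolding sc by (simp add: field_simps power2_eq_square)
  finally show ?thesis unfolding a using pos den by (simp add: c_def)
qed

section \<open>The Ott-Antonsen profile as image of the uniform law under \<open>phi\<close>\<close>

lemma measurable_phi [measurable]:
  assumes "0 \<le> \<beta>" "\<beta> < 1"
  shows "phi \<alpha> \<beta> A \<in> borel_measurable borel"
proof -
  have "phi \<alpha> \<beta> A = (\<lambda>\<xi>. moebius_lift \<beta> (pi * \<xi> + A) - \<alpha>)"
    using phi_eq_moebius_lift[OF assms] by auto
  then show ?thesis unfolding moebius_lift_def by simp
qed

lemma phi_has_derivative:
  assumes "0 \<le> \<beta>" "\<beta> < 1"
  shows "(phi \<alpha> \<beta> A has_real_derivative
    2 * pi * (1 - \<beta>\<^sup>2) / (1 + 2 * \<beta> * cos (2 * (pi * \<xi> + A)) + \<beta>\<^sup>2)) (at \<xi>)"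
proof -
  have eq: "phi \<alpha> \<beta> A = (\<lambda>\<xi>. moebius_lift \<beta> (pi * \<xi> + A) - \<alpha>)"
    using phi_eq_moebius_lift[OF assms] by auto
  have "((\<lambda>\<xi>. pi * \<xi> + A) has_real_derivative pi) (at \<xi>)"
    by (auto intro!: derivative_eq_intros)
  from DERIV_chain2[OF moebius_lift_has_derivative[OF assms] this]
  show ?thesis unfolding eq by (auto intro!: derivative_eq_intros simp: mult_ac)
qed

lemma phi_mono:
  assumes "0 \<le> \<beta>" "\<beta> < 1" "\<xi> \<le> \<eta>"
  shows "phi \<alpha> \<beta> A \<xi> \<le> phi \<alpha> \<beta> A \<eta>"
proof (rule DERIV_nonneg_imp_nondecreasing[OF assms(3)])
  fix x
  have "0 \<le> 2 * pi * (1 - \<beta>\<^sup>2) / (1 + 2 * \<beta> * cos (2 * (pi * x + A)) + \<beta>\<^sup>2)"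
    using assms poisson_den_pos[of \<beta> "2 * (pi * x + A)"]
    by (intro divide_nonneg_pos mult_nonneg_nonneg) (auto simp: abs_square_le_1)
  then show "\<exists>y. DERIV (phi \<alpha> \<beta> A) x :> y \<and> 0 \<le> y"
    using phi_has_derivative assms by blast
qed

lemma phi_plus_1:
  assumes "0 \<le> \<beta>" "\<beta> < 1"
  shows "phi \<alpha> \<beta> A (\<xi> + 1) = phi \<alpha> \<beta> A \<xi> + 2 * pi"
  using moebius_lift_add_pi[of \<beta> "pi * \<xi> + A" 1]
  by (simp add: phi_eq_moebius_lift[OF assms] algebra_simps)

text \<open>Conservation of mass: the density at the image point is the reciprocal of the derivative
  of \<open>phi\<close>. The Poisson denominators at source and image multiply to
  \<open>(1 - \<beta>\<^sup>2)\<^sup>2\<close>.\<close>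

lemma OA_density_phi:
  assumes "0 \<le> \<beta>" "\<beta> < 1"
  shows "OA_density \<alpha> \<beta> (phi \<alpha> \<beta> A \<xi>)
    * (2 * pi * (1 - \<beta>\<^sup>2) / (1 + 2 * \<beta> * cos (2 * (pi * \<xi> + A)) + \<beta>\<^sup>2)) = 1"
proof -
  define c where "c = cos (2 * (pi * \<xi> + A))"
  have den: "0 < 1 + 2 * \<beta> * c + \<beta>\<^sup>2" unfolding c_def using assms by (rule poisson_den_pos)
  have b: "0 < 1 - \<beta>\<^sup>2" using assms by (simp add: abs_square_less_1)
  have "cos (\<alpha> + phi \<alpha> \<beta> A \<xi>) = ((1 + \<beta>\<^sup>2) * c + 2 * \<beta>) / (1 + 2 * \<beta> * c + \<beta>\<^sup>2)"
    using cos_moebius_lift[OF assms, of "pi * \<xi> + A"] by (simp add: phi_eq_moebius_lift[OF assms] c_def)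
  then have "1 - 2 * \<beta> * cos (\<alpha> + phi \<alpha> \<beta> A \<xi>) + \<beta>\<^sup>2 = (1 - \<beta>\<^sup>2)\<^sup>2 / (1 + 2 * \<beta> * c + \<beta>\<^sup>2)"
    using den by (simp add: field_simps power2_eq_square)
  then show ?thesis
    unfolding OA_density_def c_def[symmetric] using den b by (simp add: power2_eq_square)
qed

lemma OA_density_nonneg:
  assumes "0 \<le> \<beta>" "\<beta> < 1"
  shows "0 \<le> OA_density \<alpha> \<beta> \<theta>"
  using assms poisson_den_pos[of \<beta> "\<alpha> + \<theta> + pi"]
  unfolding OA_density_def by (simp add: abs_square_le_1 add.commute)

lemma measurable_OA_density [measurable]: "OA_density \<alpha> \<beta> \<in> borel_measurable borel"
  unfolding OA_density_def [abs_def] by measurable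

lemma to_torus_plus_2pi: "to_torus (x + 2 * pi) = to_torus x"
  by (simp add: torus.abs_eq_iff exI[of _ 1])

text \<open>Change of variables by \<open>phi\<close>. The parameter \<open>A\<close> only decides
  where the period starts, which an integral of a periodic function does not see; any
  \<open>A\<close> may therefore be chosen in the coupling.\<close>

lemma OA_measure_eq_distr:
  assumes \<beta>: "0 \<le> \<beta>" "\<beta> < 1"
  shows "distr unif01 borel (\<lambda>\<xi>. to_torus (phi \<alpha> \<beta> A \<xi>)) = OA_measure \<alpha> \<beta>"
proof (rule measure_eqI)
  show "sets (distr unif01 borel (\<lambda>\<xi>. to_torus (phi \<alpha> \<beta> A \<xi>))) = sets (OA_measure \<alpha> \<beta>)"
    by (simp add: OA_measure_def)
  fix E assume "E \<in> sets (distr unif01 borel (\<lambda>\<xi>. to_torus (phi \<alpha> \<beta> A \<xi>)))"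
  then have E [measurable]: "E \<in> sets borel" by simp
  have [measurable]: "phi \<alpha> \<beta> A \<in> borel_measurable borel" by (rule measurable_phi[OF \<beta>])
  define h where "h \<theta> = indicator E (to_torus \<theta>) * ennreal (OA_density \<alpha> \<beta> \<theta>)" for \<theta>
  have h [measurable]: "h \<in> borel_measurable borel" unfolding h_def by measurable
  have per: "h (\<theta> + 2 * pi) = h \<theta>" for \<theta>
    unfolding h_def to_torus_plus_2pi OA_density_def
    using cos_periodic[of "\<alpha> + \<theta>"] by (simp add: add.assoc)
  define g where "g = phi \<alpha> \<beta> A"
  define g' where "g' \<xi> = 2 * pi * (1 - \<beta>\<^sup>2) / (1 + 2 * \<beta> * cos (2 * (pi * \<xi> + A)) + \<beta>\<^sup>2)" for \<xi>
  have g'_nonneg: "0 \<le> g' \<xi>" for \<xi>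
    unfolding g'_def using \<beta> poisson_den_pos[of \<beta> "2 * (pi * \<xi> + A)"]
    by (intro divide_nonneg_pos mult_nonneg_nonneg) (auto simp: abs_square_le_1)
  have g1: "g 1 = g 0 + 2 * pi" using phi_plus_1[OF \<beta>, of \<alpha> A 0] by (simp add: g_def)
  have "emeasure (OA_measure \<alpha> \<beta>) E = (\<integral>\<^sup>+\<theta>. indicator E \<theta> \<partial>OA_measure \<alpha> \<beta>)"
    by (simp add: OA_measure_def)
  also have "\<dots> = (\<integral>\<^sup>+\<theta>. indicator E (to_torus \<theta>)
      \<partial>density lborel (\<lambda>\<theta>. ennreal (OA_density \<alpha> \<beta> \<theta>) * indicator {- pi..<pi} \<theta>))"
    unfolding OA_measure_def by (rule nn_integral_distr) auto
  also have "\<dots> = (\<integral>\<^sup>+\<theta>\<in>{- pi..<- pi + 2 * pi}. h \<theta> \<partial>lborel)"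
    unfolding h_def by (subst nn_integral_density) (auto intro!: nn_integral_cong simp: indicator_def)
  \<comment> \<open>The fundamental domain moves from \<open>- pi\<close> to the starting point of
    the image of \<open>g\<close>.\<close>
  also have "\<dots> = (\<integral>\<^sup>+\<theta>\<in>{g 0..<g 0 + 2 * pi}. h \<theta> \<partial>lborel)"
    by (rule nn_integral_over_period) (auto simp: per)
  \<comment> \<open>Adding the right end point, a null set, makes the interval closed as in the
    substitution rule.\<close>
  also have "\<dots> = (\<integral>\<^sup>+\<theta>\<in>{g 0..g 1}. h \<theta> \<partial>lborel)"
    using AE_lborel_singleton[of "g 1"]
    by (intro nn_integral_cong_AE) (auto simp: indicator_def g1 elim!: eventually_mono)
  also have "\<dots> = (\<integral>\<^sup>+\<xi>\<in>{0..1}. h (g \<xi>) * ennreal (g' \<xi>) \<partial>lborel)"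
  proof (rule nn_integral_substitution_aux)
    show "continuous_on {0..1} g'"
      unfolding g'_def using poisson_den_pos[OF \<beta>] by (intro continuous_intros) (auto simp: less_imp_neq[symmetric])
    show "(g has_real_derivative g' \<xi>) (at \<xi>)" for \<xi>
      unfolding g_def g'_def by (rule phi_has_derivative[OF \<beta>])
  qed (auto simp: g'_nonneg)
  also have "\<dots> = (\<integral>\<^sup>+\<xi>\<in>{0..<1}. indicator E (to_torus (g \<xi>)) \<partial>lborel)"
  proof -
    have "h (g \<xi>) * ennreal (g' \<xi>) = indicator E (to_torus (g \<xi>))" for \<xi>
    proof -
      have "OA_density \<alpha> \<beta> (g \<xi>) * g' \<xi> = 1"
        unfolding g_def g'_def by (rule OA_density_phi[OF \<beta>])
      then have "ennreal (OA_density \<alpha> \<beta> (g \<xi>)) * ennreal (g' \<xi>) = 1"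
        using OA_density_nonneg[OF \<beta>] g'_nonneg by (simp flip: ennreal_mult)
      then show ?thesis by (simp add: h_def mult.assoc)
    qed
    then show ?thesis using AE_lborel_singleton[of "1::real"]
      by (intro nn_integral_cong_AE) (auto simp: indicator_def elim!: eventually_mono)
  qed
  also have "\<dots> = emeasure (distr unif01 borel (\<lambda>\<xi>. to_torus (phi \<alpha> \<beta> A \<xi>))) E"
    unfolding g_def by (rule emeasure_distr_unif01[symmetric]) auto
  finally show "emeasure (distr unif01 borel (\<lambda>\<xi>. to_torus (phi \<alpha> \<beta> A \<xi>))) E
      = emeasure (OA_measure \<alpha> \<beta>) E" ..
qed

section \<open>Transport cost\<close>

lemma abs_arctan_diff_le: "\<bar>arctan x - arctan y\<bar> \<le> \<bar>x - y\<bar>"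
proof -
  have "norm (arctan x - arctan y) \<le> 1 * norm (x - y)"
  proof (rule field_differentiable_bound[of UNIV])
    show "(arctan has_field_derivative inverse (1 + z\<^sup>2)) (at z within UNIV)" for z :: real
      by (rule DERIV_arctan)
    show "norm (inverse (1 + z\<^sup>2)) \<le> 1" for z :: real
      by (simp add: inverse_le_1_iff add_pos_nonneg)
  qed auto
  then show ?thesis by simp
qed

text \<open>With the same \<open>A\<close> and \<open>\<xi>\<close> the branch terms cancel, and the
  factor of the tangent is Lipschitz in \<open>\<beta>\<close> with constant \<open>2\<close>. The
  bound degenerates near the poles of the tangent.\<close>

lemma phi_diff_le:
  assumes "0 \<le> \<beta>1" "0 \<le> \<beta>2"
  shows "\<bar>phi \<alpha>1 \<beta>1 A \<xi> - phi \<alpha>2 \<beta>2 A \<xi>\<bar>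
    \<le> \<bar>\<alpha>1 - \<alpha>2\<bar> + 4 * \<bar>\<beta>1 - \<beta>2\<bar> * \<bar>tan (pi * \<xi> + A)\<bar>"
proof -
  define T c1 c2 where "T = tan (pi * \<xi> + A)"
    and "c1 = (1 - \<beta>1) / (1 + \<beta>1)" and "c2 = (1 - \<beta>2) / (1 + \<beta>2)"
  have "c1 - c2 = 2 * (\<beta>2 - \<beta>1) / ((1 + \<beta>1) * (1 + \<beta>2))"
    unfolding c1_def c2_def using assms by (simp add: field_simps)
  then have "\<bar>c1 - c2\<bar> = 2 * \<bar>\<beta>1 - \<beta>2\<bar> / ((1 + \<beta>1) * (1 + \<beta>2))"
    using assms by (simp only: abs_mult abs_divide) (simp add: abs_minus_commute)
  also have "\<dots> \<le> 2 * \<bar>\<beta>1 - \<beta>2\<bar> / 1"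
    using assms by (intro divide_left_mono mult_ge1_I) auto
  finally have c: "\<bar>c1 - c2\<bar> \<le> 2 * \<bar>\<beta>1 - \<beta>2\<bar>" by simp
  have "\<bar>arctan (c1 * T) - arctan (c2 * T)\<bar> \<le> \<bar>c1 - c2\<bar> * \<bar>T\<bar>"
    using abs_arctan_diff_le[of "c1 * T" "c2 * T"] by (simp add: abs_mult flip: left_diff_distrib)
  also have "\<dots> \<le> 2 * \<bar>\<beta>1 - \<beta>2\<bar> * \<bar>T\<bar>"
    using c by (intro mult_right_mono) auto
  finally have d: "\<bar>arctan (c1 * T) - arctan (c2 * T)\<bar> \<le> 2 * \<bar>\<beta>1 - \<beta>2\<bar> * \<bar>T\<bar>" .
  show ?thesis
  proof (cases "cos (pi * \<xi> + A) = 0")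
    case False
    then have "phi \<alpha>1 \<beta>1 A \<xi> - phi \<alpha>2 \<beta>2 A \<xi>
        = 2 * (arctan (c1 * T) - arctan (c2 * T)) + (\<alpha>2 - \<alpha>1)"
      by (simp add: phi_def Let_def c1_def c2_def T_def)
    then have "\<bar>phi \<alpha>1 \<beta>1 A \<xi> - phi \<alpha>2 \<beta>2 A \<xi>\<bar>
        \<le> 2 * \<bar>arctan (c1 * T) - arctan (c2 * T)\<bar> + \<bar>\<alpha>1 - \<alpha>2\<bar>"
      using abs_triangle_ineq[of "2 * (arctan (c1 * T) - arctan (c2 * T))" "\<alpha>2 - \<alpha>1"]
      unfolding abs_mult by (simp add: abs_minus_commute)
    also have "\<dots> \<le> 2 * (2 * \<bar>\<beta>1 - \<beta>2\<bar> * \<bar>T\<bar>) + \<bar>\<alpha>1 - \<alpha>2\<bar>"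
      by (intro add_right_mono mult_left_mono d) simp
    finally show ?thesis by (simp add: T_def)
  \<comment> \<open>At a pole both values are of the form \<open>2 * u - \<alpha>\<close>, in which
    \<open>\<beta>\<close> does not occur.\<close>
  qed (simp add: phi_def Let_def abs_minus_commute[of \<alpha>2])
qed

text \<open>The mean over \<open>\<xi>\<close> of the bound in \<open>phi_diff_le\<close>. It is
  truncated at the diameter of the circle because the tangent is not integrable over a
  period.\<close>

definition tan_modulus :: "real \<Rightarrow> ennreal" where
  "tan_modulus d = (\<integral>\<^sup>+\<xi>\<in>{0..<1}. ennreal (min pi (d * \<bar>tan (pi * \<xi>)\<bar>)) \<partial>lborel)"

text \<open>The period of the tangent removes \<open>A\<close>, which makes the transport bound
  uniform in \<open>A\<close>.\<close>

lemma tan_modulus_shift: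
  "(\<integral>\<^sup>+\<xi>\<in>{0..<1}. ennreal (min pi (d * \<bar>tan (pi * \<xi> + A)\<bar>)) \<partial>lborel) = tan_modulus d"
proof -
  define h where "h x = ennreal (min pi (d * \<bar>tan (pi * x)\<bar>))" for x
  have [measurable]: "h \<in> borel_measurable borel"
    unfolding h_def tan_def by measurable
  have per: "h (x + 1) = h x" for x
    using tan_periodic_pi[of "pi * x"] by (simp add: h_def algebra_simps)
  have "tan_modulus d = (\<integral>\<^sup>+x\<in>{0..<0 + 1}. h x \<partial>lborel)"
    by (simp add: tan_modulus_def h_def)
  also have "\<dots> = (\<integral>\<^sup>+x\<in>{A / pi..<A / pi + 1}. h x \<partial>lborel)"
    by (rule nn_integral_over_period) (auto simp: per)
  also have "\<dots> = (\<integral>\<^sup>+\<xi>. h (A / pi + 1 * \<xi>) * indicator {A / pi..<A / pi + 1} (A / pi + 1 * \<xi>) \<partial>lborel)"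
    by (subst nn_integral_real_affine[where c = 1 and t = "A / pi"]) auto
  also have "\<dots> = (\<integral>\<^sup>+\<xi>\<in>{0..<1}. ennreal (min pi (d * \<bar>tan (pi * \<xi> + A)\<bar>)) \<partial>lborel)"
    by (intro nn_integral_cong) (auto simp: indicator_def h_def distrib_left add.commute)
  finally show ?thesis ..
qed

lemma tan_modulus_mono: "d \<le> d' \<Longrightarrow> tan_modulus d \<le> tan_modulus d'"
  unfolding tan_modulus_def
proof (intro nn_integral_mono mult_right_mono ennreal_leI)
  fix \<xi> :: real assume "d \<le> d'"
  then have "d * \<bar>tan (pi * \<xi>)\<bar> \<le> d' * \<bar>tan (pi * \<xi>)\<bar>" by (rule mult_right_mono) simp
  then show "min pi (d * \<bar>tan (pi * \<xi>)\<bar>) \<le> min pi (d' * \<bar>tan (pi * \<xi>)\<bar>)" by linarith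
qed simp

text \<open>Dominated convergence along \<open>d = 1 / (n + 1)\<close>: the integrand is at most
  \<open>pi\<close> and tends to \<open>0\<close> for each fixed \<open>\<xi>\<close>.\<close>

lemma tan_modulus_small:
  assumes "e > 0"
  obtains d where "d > 0" "tan_modulus d < e"
proof -
  define s where "s n \<xi> = ennreal (min pi (1 / real (Suc n) * \<bar>tan (pi * \<xi>)\<bar>)) * indicator {0..<1} \<xi>" for n \<xi>
  have "(\<lambda>n. \<integral>\<^sup>+\<xi>. s n \<xi> \<partial>lborel) \<longlonglongrightarrow> nn_integral lborel (\<lambda>_::real. 0)"
  proof (rule nn_integral_dominated_convergence[where w = "\<lambda>\<xi>. ennreal pi * indicator {0..<1} \<xi>"])
    show "s n \<in> borel_measurable lborel" for n unfolding s_def tan_def by measurable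
    show "(\<lambda>\<xi>. ennreal pi * indicator {0..<1::real} \<xi>) \<in> borel_measurable lborel" by measurable
    show "(\<integral>\<^sup>+\<xi>. ennreal pi * indicator {0..<1::real} \<xi> \<partial>lborel) < \<infinity>"
      by (simp add: nn_integral_cmult_indicator ennreal_mult_less_top)
    show "AE \<xi> in lborel. s n \<xi> \<le> ennreal pi * indicator {0..<1} \<xi>" for n
      unfolding s_def by (intro always_eventually allI mult_right_mono ennreal_leI) auto
    show "AE \<xi> in lborel. (\<lambda>n. s n \<xi>) \<longlonglongrightarrow> 0"
    proof (intro always_eventually allI)
      fix \<xi> :: real
      have "(\<lambda>n. 1 / real (Suc n) * \<bar>tan (pi * \<xi>)\<bar>) \<longlonglongrightarrow> 0 * \<bar>tan (pi * \<xi>)\<bar>"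
        using LIMSEQ_inverse_real_of_nat by (intro tendsto_mult tendsto_const) (simp add: inverse_eq_divide)
      from tendsto_min[OF tendsto_const[of pi] this]
      have "(\<lambda>n. ennreal (min pi (1 / real (Suc n) * \<bar>tan (pi * \<xi>)\<bar>))) \<longlonglongrightarrow> ennreal 0"
        by (intro tendsto_ennrealI) simp
      then show "(\<lambda>n. s n \<xi>) \<longlonglongrightarrow> 0"
        unfolding s_def by (cases "\<xi> \<in> {0..<1}") (simp_all add: indicator_def)
    qed
  qed simp
  then have "(\<lambda>n. tan_modulus (1 / real (Suc n))) \<longlonglongrightarrow> 0"
    by (simp add: tan_modulus_def s_def)
  from order_tendstoD(2)[OF this assms]
  obtain n where "tan_modulus (1 / real (Suc n)) < e" by (auto simp: eventually_sequentially)
  then show ?thesis by (intro that[of "1 / real (Suc n)"]) auto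
qed

text \<open>By monotonicity both values lie between those at the ends of the cell, so the error is
  at most the increment over the cell. The increments telescope to \<open>2 * pi\<close>. No
  Lipschitz constant enters, hence the uniformity in \<open>\<beta>\<close>.\<close>

lemma nn_integral_phi_midpoint:
  assumes \<beta>: "0 \<le> \<beta>" "\<beta> < 1" and N: "N > 0"
  shows "(\<integral>\<^sup>+\<xi>\<in>{0..<1}. ennreal \<bar>phi_i N \<alpha> \<beta> A (cell N \<xi>) - phi \<alpha> \<beta> A \<xi>\<bar> \<partial>lborel)
    \<le> ennreal (2 * pi / real N)"
proof -
  define g where "g = phi \<alpha> \<beta> A"
  define \<Delta> where "\<Delta> i = g (real i / real N) - g ((real i - 1) / real N)" for i :: nat
  have mono: "x \<le> y \<Longrightarrow> g x \<le> g y" for x y unfolding g_def by (rule phi_mono[OF \<beta>])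
  have \<Delta>_nonneg: "0 \<le> \<Delta> i" for i
    unfolding \<Delta>_def using mono[of "(real i - 1) / real N" "real i / real N"] by (simp add: divide_right_mono)
  have "ennreal \<bar>phi_i N \<alpha> \<beta> A (cell N \<xi>) - phi \<alpha> \<beta> A \<xi>\<bar> * indicator {0..<1} \<xi>
      \<le> ennreal (\<Delta> (cell N \<xi>)) * indicator {0..<1} \<xi>" for \<xi>
  proof (cases "\<xi> \<in> {0..<1}")
    case True
    define i where "i = cell N \<xi>"
    define m where "m = (2 * real i - 1) / (2 * real N)"
    have "\<xi> \<in> {(real i - 1) / real N..<real i / real N}"
      using cell_eq_iff[of \<xi> N i] cell_in[of \<xi> N] True N by (auto simp: i_def)
    then have "g ((real i - 1) / real N) \<le> g \<xi>" "g \<xi> \<le> g (real i / real N)"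
      by (auto intro: mono)
    moreover have "(real i - 1) / real N \<le> m" "m \<le> real i / real N"
      unfolding m_def using N by (auto simp: field_simps)
    then have "g ((real i - 1) / real N) \<le> g m" "g m \<le> g (real i / real N)"
      by (auto intro: mono)
    ultimately have "\<bar>g m - g \<xi>\<bar> \<le> \<Delta> i" unfolding \<Delta>_def by linarith
    then show ?thesis
      using True by (simp add: phi_i_def g_def i_def[symmetric] m_def ennreal_leI)
  qed simp
  then have "(\<integral>\<^sup>+\<xi>\<in>{0..<1}. ennreal \<bar>phi_i N \<alpha> \<beta> A (cell N \<xi>) - phi \<alpha> \<beta> A \<xi>\<bar> \<partial>lborel)
      \<le> (\<integral>\<^sup>+\<xi>\<in>{0..<1}. ennreal (\<Delta> (cell N \<xi>)) \<partial>lborel)"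
    by (rule nn_integral_mono)
  also have "\<dots> = ennreal (1 / real N) * ennreal (\<Sum>i=1..N. \<Delta> i)"
    using nn_integral_cells[OF N, of "\<lambda>i. ennreal (\<Delta> i)"] \<Delta>_nonneg by (simp add: sum_ennreal)
  also have "(\<Sum>i=1..N. \<Delta> i) = (\<Sum>i\<in>{Suc 0..N}. g (real i / real N) - g (real (i - 1) / real N))"
    unfolding \<Delta>_def by (intro sum.cong) (auto simp: of_nat_diff)
  also have "\<dots> = g (real N / real N) - g (real 0 / real N)"
    by (rule sum_telescope''[where f = "\<lambda>i. g (real i / real N)"]) simp
  also have "\<dots> = 2 * pi" using N phi_plus_1[OF \<beta>, of \<alpha> A 0] by (simp add: g_def)
  finally show ?thesis by (simp flip: ennreal_mult)
qed

lemma transport_cost_le: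
  assumes \<beta>1: "0 \<le> \<beta>1" "\<beta>1 < 1" and \<beta>2: "0 \<le> \<beta>2" "\<beta>2 < 1" and N: "N > 0" and p: "p \<ge> 1"
  shows "transport_cost p (empirical_measure N (theta N \<alpha>1 \<beta>1 A)) (OA_measure \<alpha>2 \<beta>2)
    \<le> ennreal (pi powr (p - 1)) *
      (ennreal (2 * pi / real N) + (ennreal \<bar>\<alpha>1 - \<alpha>2\<bar> + tan_modulus (4 * \<bar>\<beta>1 - \<beta>2\<bar>)))"
proof -
  have [measurable]: "phi \<alpha>1 \<beta>1 A \<in> borel_measurable borel" "phi \<alpha>2 \<beta>2 A \<in> borel_measurable borel"
    using \<beta>1 \<beta>2 by (auto intro: measurable_phi)
  define X where "X \<xi> = theta N \<alpha>1 \<beta>1 A (cell N \<xi>)" for \<xi>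
  define Y where "Y \<xi> = to_torus (phi \<alpha>2 \<beta>2 A \<xi>)" for \<xi>
  have [measurable]: "X \<in> borel_measurable borel" "Y \<in> borel_measurable borel"
    unfolding X_def Y_def by measurable
  have XY [measurable]: "(\<lambda>\<xi>. (X \<xi>, Y \<xi>)) \<in> unif01 \<rightarrow>\<^sub>M borel \<Otimes>\<^sub>M borel" by measurable
  \<comment> \<open>The coupling is the joint law of the sampled map and the exact map, driven by
    one uniform \<open>\<xi>\<close> and the same \<open>A\<close>.\<close>
  define \<gamma> where "\<gamma> = distr unif01 (borel \<Otimes>\<^sub>M borel) (\<lambda>\<xi>. (X \<xi>, Y \<xi>))"
  have "coupling (empirical_measure N (theta N \<alpha>1 \<beta>1 A)) (OA_measure \<alpha>2 \<beta>2) \<gamma>"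
    unfolding coupling_def
  proof (intro conjI)
    show "prob_space \<gamma>"
      unfolding \<gamma>_def by (rule prob_space.prob_space_distr[OF prob_space_unif01 XY])
    show "sets \<gamma> = sets (borel \<Otimes>\<^sub>M borel)" by (simp add: \<gamma>_def)
    show "distr \<gamma> borel fst = empirical_measure N (theta N \<alpha>1 \<beta>1 A)"
      unfolding \<gamma>_def by (subst distr_distr) (auto simp: o_def X_def empirical_measure_eq_distr[OF N])
    show "distr \<gamma> borel snd = OA_measure \<alpha>2 \<beta>2"
      unfolding \<gamma>_def by (subst distr_distr) (auto simp: o_def Y_def OA_measure_eq_distr[OF \<beta>2])
  qed
  then have "transport_cost p (empirical_measure N (theta N \<alpha>1 \<beta>1 A)) (OA_measure \<alpha>2 \<beta>2)
      \<le> (\<integral>\<^sup>+z. ennreal (dist (fst z) (snd z) powr p) \<partial>\<gamma>)"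
    unfolding transport_cost_def by (intro INF_lower) simp
  also have "\<dots> = (\<integral>\<^sup>+\<xi>\<in>{0..<1}. ennreal (dist (X \<xi>) (Y \<xi>) powr p) \<partial>lborel)"
    unfolding \<gamma>_def by (subst nn_integral_distr) (auto simp: nn_integral_unif01)
  also have "\<dots> \<le> (\<integral>\<^sup>+\<xi>. ennreal (pi powr (p - 1)) *
      (ennreal \<bar>phi_i N \<alpha>1 \<beta>1 A (cell N \<xi>) - phi \<alpha>1 \<beta>1 A \<xi>\<bar> * indicator {0..<1} \<xi>
       + (ennreal \<bar>\<alpha>1 - \<alpha>2\<bar> * indicator {0..<1} \<xi>
          + ennreal (min pi (4 * \<bar>\<beta>1 - \<beta>2\<bar> * \<bar>tan (pi * \<xi> + A)\<bar>)) * indicator {0..<1} \<xi>)) \<partial>lborel)"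
  proof (rule nn_integral_mono)
    fix \<xi> :: real
    define d where "d = dist (X \<xi>) (Y \<xi>)"
    define a where "a = \<bar>phi_i N \<alpha>1 \<beta>1 A (cell N \<xi>) - phi \<alpha>1 \<beta>1 A \<xi>\<bar>"
    define b where "b = min pi (4 * \<bar>\<beta>1 - \<beta>2\<bar> * \<bar>tan (pi * \<xi> + A)\<bar>)"
    have b: "0 \<le> b" by (simp add: b_def)
    have d: "0 \<le> d" "d \<le> pi" unfolding d_def by (simp_all add: dist_torus_le_pi)
    have "d \<le> \<bar>phi_i N \<alpha>1 \<beta>1 A (cell N \<xi>) - phi \<alpha>2 \<beta>2 A \<xi>\<bar>"
      unfolding d_def X_def Y_def theta_def using dist_to_torus_le by (simp add: dist_real_def)
    also have "\<dots> \<le> a + (\<bar>\<alpha>1 - \<alpha>2\<bar> + 4 * \<bar>\<beta>1 - \<beta>2\<bar> * \<bar>tan (pi * \<xi> + A)\<bar>)"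
      using phi_diff_le[OF \<beta>1(1) \<beta>2(1), of \<alpha>1 A \<xi> \<alpha>2] unfolding a_def by linarith
    \<comment> \<open>As \<open>d\<close> is at most \<open>pi\<close> and the other terms are
      nonnegative, the tangent term may be truncated.\<close>
    finally have "d \<le> a + (\<bar>\<alpha>1 - \<alpha>2\<bar> + b)"
      using d unfolding b_def a_def by linarith
    \<comment> \<open>All but one of the \<open>p\<close> factors are bounded by the diameter,
      leaving a first-order cost to integrate.\<close>
    moreover have "d powr p \<le> pi powr (p - 1) * d"
    proof (cases "d = 0")
      case False
      then have "d powr p = d powr (p - 1) * d" using d by (simp add: powr_mult_base' powr_diff)
      also have "\<dots> \<le> pi powr (p - 1) * d" using d p by (intro mult_right_mono powr_mono2) auto
      finally show ?thesis .
    qed simp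
    ultimately have "d powr p \<le> pi powr (p - 1) * (a + (\<bar>\<alpha>1 - \<alpha>2\<bar> + b))"
      by (meson mult_left_mono order_trans powr_ge_zero)
    then have "ennreal (d powr p)
        \<le> ennreal (pi powr (p - 1)) * (ennreal a + (ennreal \<bar>\<alpha>1 - \<alpha>2\<bar> + ennreal b))"
      using b by (simp add: a_def ennreal_leI flip: ennreal_plus ennreal_mult)
    then show "ennreal (dist (X \<xi>) (Y \<xi>) powr p) * indicator {0..<1} \<xi>
        \<le> ennreal (pi powr (p - 1)) * (ennreal \<bar>phi_i N \<alpha>1 \<beta>1 A (cell N \<xi>) - phi \<alpha>1 \<beta>1 A \<xi>\<bar> * indicator {0..<1} \<xi>
       + (ennreal \<bar>\<alpha>1 - \<alpha>2\<bar> * indicator {0..<1} \<xi>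
          + ennreal (min pi (4 * \<bar>\<beta>1 - \<beta>2\<bar> * \<bar>tan (pi * \<xi> + A)\<bar>)) * indicator {0..<1} \<xi>))"
      unfolding d_def a_def b_def by (cases "\<xi> \<in> {0..<1}") simp_all
  qed
  also have "\<dots> = ennreal (pi powr (p - 1)) *
      ((\<integral>\<^sup>+\<xi>\<in>{0..<1}. ennreal \<bar>phi_i N \<alpha>1 \<beta>1 A (cell N \<xi>) - phi \<alpha>1 \<beta>1 A \<xi>\<bar> \<partial>lborel)
       + (ennreal \<bar>\<alpha>1 - \<alpha>2\<bar> + tan_modulus (4 * \<bar>\<beta>1 - \<beta>2\<bar>)))"
    unfolding tan_modulus_shift[of _ A, symmetric] tan_def
    by (simp add: nn_integral_cmult nn_integral_add nn_integral_cmult_indicator)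
  also have "\<dots> \<le> ennreal (pi powr (p - 1)) *
      (ennreal (2 * pi / real N) + (ennreal \<bar>\<alpha>1 - \<alpha>2\<bar> + tan_modulus (4 * \<bar>\<beta>1 - \<beta>2\<bar>)))"
    by (intro mult_left_mono add_right_mono nn_integral_phi_midpoint[OF \<beta>1 N]) auto
  finally show ?thesis .
qed

lemma wasserstein_le:
  assumes "transport_cost p \<mu> \<nu> \<le> ennreal (e powr p)" and "e > 0" "p \<ge> 1"
  shows "wasserstein p \<mu> \<nu> \<le> ennreal e"
proof -
  have "enn2real (transport_cost p \<mu> \<nu>) \<le> e powr p"
    using enn2real_mono[OF assms(1)] by simp
  then have "enn2real (transport_cost p \<mu> \<nu>) powr (1 / p) \<le> (e powr p) powr (1 / p)"
    using assms by (intro powr_mono2) auto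
  also have "\<dots> = e" using assms by (simp add: powr_powr)
  finally show ?thesis
    using assms(1) by (auto simp: wasserstein_def ennreal_leI top_unique)
qed

text \<open>The threshold \<delta> is chosen before all parameters and does not degrade as \<beta>
  approaches \<open>1\<close>, so it serves all times at once.\<close>

lemma wasserstein_uniformly_small:
  assumes e: "e > 0" and p: "p \<ge> 1"
  obtains \<delta> where "\<delta> > 0"
    and "\<And>N \<alpha>1 \<alpha>2 \<beta>1 \<beta>2 A. \<lbrakk>0 \<le> \<beta>1; \<beta>1 < 1; 0 \<le> \<beta>2; \<beta>2 < 1; N > 0; 1 / real N \<le> \<delta>;
        \<bar>\<alpha>1 - \<alpha>2\<bar> \<le> \<delta>; \<bar>\<beta>1 - \<beta>2\<bar> \<le> \<delta>\<rbrakk>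
      \<Longrightarrow> wasserstein p (empirical_measure N (theta N \<alpha>1 \<beta>1 A)) (OA_measure \<alpha>2 \<beta>2) \<le> ennreal e"
proof -
  \<comment> \<open>Three error terms of size \<eta>, times the prefactor
    \<open>pi powr (p - 1)\<close>, add up to exactly \<open>e powr p\<close>.\<close>
  define \<eta> where "\<eta> = e powr p / (3 * pi powr (p - 1))"
  have \<eta>: "\<eta> > 0" using e by (simp add: \<eta>_def)
  obtain d where d: "d > 0" "tan_modulus d < ennreal \<eta>"
    using tan_modulus_small[of "ennreal \<eta>"] \<eta> by auto
  \<comment> \<open>The factors \<open>4\<close> and \<open>2 * pi\<close> compensate those in
    \<open>transport_cost_le\<close>.\<close>
  define \<delta> where "\<delta> = min (d / 4) (min \<eta> (\<eta> / (2 * pi)))"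
  have "\<delta> > 0" using d \<eta> by (simp add: \<delta>_def)
  moreover have "wasserstein p (empirical_measure N (theta N \<alpha>1 \<beta>1 A)) (OA_measure \<alpha>2 \<beta>2) \<le> ennreal e"
    if "0 \<le> \<beta>1" "\<beta>1 < 1" "0 \<le> \<beta>2" "\<beta>2 < 1" "N > 0" "1 / real N \<le> \<delta>"
      "\<bar>\<alpha>1 - \<alpha>2\<bar> \<le> \<delta>" "\<bar>\<beta>1 - \<beta>2\<bar> \<le> \<delta>" for N \<alpha>1 \<alpha>2 \<beta>1 \<beta>2 A
  proof (rule wasserstein_le[OF _ e p])
    have "1 / real N \<le> \<eta> / (2 * pi)" using that by (simp add: \<delta>_def)
    then have "2 * pi * (1 / real N) \<le> 2 * pi * (\<eta> / (2 * pi))" by (intro mult_left_mono) auto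
    then have 1: "ennreal (2 * pi / real N) \<le> ennreal \<eta>" by (intro ennreal_leI) simp
    have 2: "ennreal \<bar>\<alpha>1 - \<alpha>2\<bar> \<le> ennreal \<eta>" using that by (intro ennreal_leI) (simp add: \<delta>_def)
    have "tan_modulus (4 * \<bar>\<beta>1 - \<beta>2\<bar>) \<le> tan_modulus d"
      using that by (intro tan_modulus_mono) (simp add: \<delta>_def)
    with d have 3: "tan_modulus (4 * \<bar>\<beta>1 - \<beta>2\<bar>) \<le> ennreal \<eta>" by simp
    have "transport_cost p (empirical_measure N (theta N \<alpha>1 \<beta>1 A)) (OA_measure \<alpha>2 \<beta>2)
        \<le> ennreal (pi powr (p - 1)) * (ennreal \<eta> + (ennreal \<eta> + ennreal \<eta>))"
      using that
      by (intro order_trans[OF transport_cost_le[OF _ _ _ _ _ p]] mult_left_mono add_mono 1 2 3) auto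
    also have "\<dots> = ennreal (pi powr (p - 1) * (3 * \<eta>))"
      using \<eta> by (simp flip: ennreal_plus ennreal_mult)
    also have "pi powr (p - 1) * (3 * \<eta>) = e powr p" by (simp add: \<eta>_def)
    finally show "transport_cost p (empirical_measure N (theta N \<alpha>1 \<beta>1 A)) (OA_measure \<alpha>2 \<beta>2)
        \<le> ennreal (e powr p)" .
  qed
  ultimately show ?thesis by (rule that)
qed

section \<open>The reduced dynamics\<close>

text \<open>The common majorant of \<open>B_coef - 1\<close> and \<open>D_coef\<close> in modulus;
  \<open>1 - b ^ N\<close> bounds the square root of their common denominator from below.\<close>

definition coef_bound :: "nat \<Rightarrow> real \<Rightarrow> real" where
  "coef_bound N b = b ^ (N - 2) * (1 - b\<^sup>2) / (1 - b ^ N)"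

text \<open>Compare factors: \<open>b ^ (N - 2)\<close> is at most \<open>b\<close>, and
  \<open>1 - b\<^sup>2\<close> at most \<open>1 - b ^ N\<close>. This serves small
  \<open>b\<close>.\<close>

lemma coef_bound_le_self:
  assumes "0 \<le> b" "b < 1" "N \<ge> 3"
  shows "coef_bound N b \<le> b"
proof -
  have "b ^ (N - 2) \<le> b ^ 1" "b ^ N \<le> b\<^sup>2"
    using assms by (intro power_decreasing; simp)+
  moreover have "b ^ N < 1" using assms by (intro power_less_one_iff[THEN iffD2]) auto
  moreover have "0 \<le> 1 - b\<^sup>2" using assms by (simp add: abs_square_le_1)
  ultimately have "b ^ (N - 2) * (1 - b\<^sup>2) \<le> b * (1 - b ^ N)"
    using assms by (intro mult_mono) auto
  then show ?thesis
    using \<open>b ^ N < 1\<close> by (simp add: coef_bound_def divide_le_eq)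
qed

text \<open>Factor \<open>1 - b ^ N\<close> as \<open>1 - b\<close> times a geometric sum, whose
  first \<open>N - 1\<close> terms are each at least \<open>b ^ (N - 2)\<close>. Cancelling
  \<open>1 - b\<close> keeps the bound uniform up to \<open>b = 1\<close>.\<close>

lemma coef_bound_le_inverse:
  assumes "0 \<le> b" "b < 1" "N \<ge> 3"
  shows "coef_bound N b \<le> 2 / (real N - 1)"
proof -
  have N: "b ^ N < 1" using assms by (intro power_less_one_iff[THEN iffD2]) auto
  have "(real N - 1) * b ^ (N - 2) = (\<Sum>i<N - 1. b ^ (N - 2))"
    using assms by (simp add: of_nat_diff)
  also have "\<dots> \<le> (\<Sum>i<N - 1. b ^ i)"
    using assms by (intro sum_mono power_decreasing) auto
  also have "\<dots> \<le> (\<Sum>i<N. b ^ i)"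
    using assms by (intro sum_mono2) auto
  finally have "(1 + b) * (1 - b) * ((real N - 1) * b ^ (N - 2)) \<le> 2 * (1 - b) * (\<Sum>i<N. b ^ i)"
    using assms by (intro mult_mono) auto
  also have "\<dots> = 2 * (1 - b ^ N)" by (simp add: one_diff_power_eq)
  finally have "(b ^ (N - 2) * (1 - b\<^sup>2)) * (real N - 1) \<le> 2 * (1 - b ^ N)"
    by (simp add: power2_eq_square algebra_simps)
  then show ?thesis
    using N assms by (simp add: coef_bound_def field_simps)
qed

lemma abs_divide_le_inverse:
  fixes X d r :: real
  assumes "X\<^sup>2 \<le> d" "r\<^sup>2 \<le> d" "0 < r"
  shows "\<bar>X\<bar> / d \<le> 1 / r"
proof -
  have d: "0 < d" using assms by (smt (verit) zero_less_power)
  have "\<bar>X\<bar> * r \<le> sqrt d * sqrt d"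
    using assms d by (intro mult_mono real_le_rsqrt) auto
  then show ?thesis using d assms by (simp add: field_simps)
qed

lemma power_Suc_Suc_minus: "N \<ge> 2 \<Longrightarrow> (x::real) ^ N = x ^ (N - 2) * x\<^sup>2"
  using power_add[of x "N - 2" 2] by (simp only: le_add_diff_inverse2)

lemma power_minus_squared: "((- x) ^ n)\<^sup>2 = (x::real) ^ (2 * n)"
proof -
  have "((- x) ^ n)\<^sup>2 = ((- x)\<^sup>2) ^ n" by (simp only: power_mult[symmetric] mult.commute)
  then show ?thesis by (simp add: power_mult)
qed

text \<open>The denominator is the squared modulus of \<open>(- \<beta>) ^ N + e^(2iAN)\<close>,
  which gives the lower bound.\<close>

lemma coef_denominator:
  fixes \<beta> A :: real
  assumes "\<bar>\<beta>\<bar> < 1" "N \<ge> 2"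
  defines "d \<equiv> 1 + \<beta> ^ (2 * N) + 2 * (- \<beta>) ^ N * cos (2 * A * real N)"
  shows "d = ((- \<beta>) ^ N + cos (2 * A * real N))\<^sup>2 + (sin (2 * A * real N))\<^sup>2"
    and "(1 - \<bar>\<beta>\<bar> ^ N)\<^sup>2 \<le> d" and "\<bar>\<beta>\<bar> ^ N < 1"
proof -
  define q c where "q = (- \<beta>) ^ N" and "c = cos (2 * A * real N)"
  have q2: "\<beta> ^ (2 * N) = q\<^sup>2" unfolding q_def by (simp add: power_minus_squared)
  have absq: "\<bar>\<beta>\<bar> ^ N = \<bar>q\<bar>" unfolding q_def by (simp add: power_abs)
  have c1: "c\<^sup>2 + (sin (2 * A * real N))\<^sup>2 = 1" unfolding c_def by simp
  then show "d = ((- \<beta>) ^ N + cos (2 * A * real N))\<^sup>2 + (sin (2 * A * real N))\<^sup>2"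
    unfolding d_def q2 q_def[symmetric] c_def[symmetric] by (simp add: power2_sum)
  have "\<bar>q * c\<bar> \<le> \<bar>q\<bar> * 1" unfolding abs_mult c_def by (intro mult_left_mono) auto
  then show "(1 - \<bar>\<beta>\<bar> ^ N)\<^sup>2 \<le> d"
    unfolding d_def q2 absq q_def[symmetric] c_def[symmetric] by (simp add: power2_diff abs_le_iff mult.commute)
  show "\<bar>\<beta>\<bar> ^ N < 1" using assms by (intro power_less_one_iff[THEN iffD2]) auto
qed

text \<open>Real and imaginary part of one identity: \<open>B_coef - 1 + i D_coef\<close> equals
  \<open>P * (1 - \<beta>\<^sup>2)\<close> divided by
  \<open>(- \<beta>) ^ N + e^(2iAN)\<close>.\<close>

lemma coef_identities:
  fixes \<beta> A :: real
  assumes \<beta>: "\<bar>\<beta>\<bar> < 1" and N: "N \<ge> 2"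
  defines "s \<equiv> sin (2 * A * real N)" and "c \<equiv> cos (2 * A * real N)" and "P \<equiv> (- \<beta>) ^ (N - 2)"
    and "d \<equiv> 1 + \<beta> ^ (2 * N) + 2 * (- \<beta>) ^ N * cos (2 * A * real N)"
  shows "B_coef N A \<beta> - 1 = P * (1 - \<beta>\<^sup>2) * (((- \<beta>) ^ N + c) / d)"
    and "D_coef N A \<beta> = - (P * (1 - \<beta>\<^sup>2) * (s / d))"
proof -
  have "(1 - \<bar>\<beta>\<bar> ^ N)\<^sup>2 > 0" using coef_denominator(3)[OF \<beta> N] by simp
  then have d: "d \<noteq> 0" using coef_denominator(2)[OF \<beta> N, of A] unfolding d_def by linarith
  have sq: "P\<^sup>2 = \<beta> ^ (2 * (N - 2))" unfolding P_def by (rule power_minus_squared)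
  have "2 * N - 2 = 2 * (N - 2) + 2" "2 * N = 2 * (N - 2) + 4" using N by auto
  then have e: "\<beta> ^ (2 * N - 2) = P\<^sup>2 * \<beta>\<^sup>2" "\<beta> ^ (2 * N) = P\<^sup>2 * \<beta> ^ 4"
    unfolding sq by (metis power_add)+
  have f: "(- \<beta>) ^ N = P * \<beta>\<^sup>2" unfolding P_def using power_Suc_Suc_minus[OF N, of "- \<beta>"] by simp
  have "B_coef N A \<beta> - 1 = ((1 + P\<^sup>2 * \<beta>\<^sup>2 + c * P * (1 + \<beta>\<^sup>2)) - d) / d"
    using d unfolding B_coef_def d_def[symmetric] by (simp add: e c_def P_def diff_divide_distrib)
  also have "(1 + P\<^sup>2 * \<beta>\<^sup>2 + c * P * (1 + \<beta>\<^sup>2)) - d = P * (1 - \<beta>\<^sup>2) * ((- \<beta>) ^ N + c)"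
    unfolding d_def e f c_def[symmetric] by (simp add: power2_eq_square power4_eq_xxxx algebra_simps)
  finally show "B_coef N A \<beta> - 1 = P * (1 - \<beta>\<^sup>2) * (((- \<beta>) ^ N + c) / d)" by simp
  have "s * P * (\<beta>\<^sup>2 - 1) = - (P * (1 - \<beta>\<^sup>2) * s)" by (simp add: algebra_simps)
  then show "D_coef N A \<beta> = - (P * (1 - \<beta>\<^sup>2) * (s / d))"
    unfolding D_coef_def d_def[symmetric] s_def[symmetric] P_def[symmetric] by simp
qed

lemma coef_abs_le:
  assumes \<beta>: "\<bar>\<beta>\<bar> < 1" and N: "N \<ge> 2"
  shows "\<bar>B_coef N A \<beta> - 1\<bar> \<le> coef_bound N \<bar>\<beta>\<bar>" "\<bar>D_coef N A \<beta>\<bar> \<le> coef_bound N \<bar>\<beta>\<bar>"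
proof -
  define s c where "s = sin (2 * A * real N)" and "c = cos (2 * A * real N)"
  define d where "d = 1 + \<beta> ^ (2 * N) + 2 * (- \<beta>) ^ N * c"
  define P where "P = (- \<beta>) ^ (N - 2)"
  note den = coef_denominator(1,2)[OF \<beta> N, of A, folded s_def c_def, folded d_def]
    coef_denominator(3)[OF \<beta> N]
  have d: "0 < d" using den(2,3) by (smt (verit) zero_less_power)
  have le: "\<bar>X\<bar> / d \<le> 1 / (1 - \<bar>\<beta>\<bar> ^ N)" if "X\<^sup>2 \<le> d" for X
    using that den(2,3) by (intro abs_divide_le_inverse) auto
  have b2: "0 \<le> 1 - \<beta>\<^sup>2" using \<beta> by (simp add: abs_square_le_1)
  have *: "\<bar>P * (1 - \<beta>\<^sup>2) * (X / d)\<bar> \<le> coef_bound N \<bar>\<beta>\<bar>" if "X\<^sup>2 \<le> d" for X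
  proof -
    have "\<bar>P * (1 - \<beta>\<^sup>2) * (X / d)\<bar> = \<bar>\<beta>\<bar> ^ (N - 2) * (1 - \<beta>\<^sup>2) * (\<bar>X\<bar> / d)"
      using b2 d by (simp add: abs_mult P_def power_abs)
    also have "\<dots> \<le> \<bar>\<beta>\<bar> ^ (N - 2) * (1 - \<beta>\<^sup>2) * (1 / (1 - \<bar>\<beta>\<bar> ^ N))"
      using b2 by (intro mult_left_mono le that) auto
    finally show ?thesis by (simp add: coef_bound_def)
  qed
  show "\<bar>B_coef N A \<beta> - 1\<bar> \<le> coef_bound N \<bar>\<beta>\<bar>"
    unfolding coef_identities(1)[OF \<beta> N] s_def[symmetric] c_def[symmetric] d_def[symmetric] P_def[symmetric]
    by (intro *) (simp add: den(1))
  show "\<bar>D_coef N A \<beta>\<bar> \<le> coef_bound N \<bar>\<beta>\<bar>"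
    unfolding coef_identities(2)[OF \<beta> N] abs_minus_cancel s_def[symmetric] c_def[symmetric] d_def[symmetric] P_def[symmetric]
    by (intro *) (simp add: den(1))
qed

section \<open>Comparison by monotonicity and the logistic equation with perturbed rate\<close>

lemma nondecreasing_of_derivative:
  fixes f f' :: "real \<Rightarrow> real"
  assumes "0 \<le> a" "a \<le> b"
    and der: "\<And>t. t \<ge> 0 \<Longrightarrow> (f has_real_derivative f' t) (at t within {0..})"
    and nonneg: "\<And>t. a < t \<Longrightarrow> t < b \<Longrightarrow> 0 \<le> f' t"
  shows "f a \<le> f b"
proof (rule DERIV_nonneg_imp_increasing_open[OF assms(2)])
  fix t assume t: "a < t" "t < b"
  then have "at t within {0..} = at t" using assms(1) by (intro at_within_interior) simp
  then show "\<exists>y. DERIV f t :> y \<and> 0 \<le> y" using der[of t] nonneg[of t] t assms(1) by auto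
next
  \<comment> \<open>At \<open>0\<close> the derivative is one-sided, so the end points enter through
    continuity only.\<close>
  have "continuous_on {0..} f"
    by (rule DERIV_continuous_on[OF der]) simp
  then show "continuous_on {a..b} f" by (rule continuous_on_subset) (use assms(1) in auto)
qed

text \<open>Covers the Ott-Antonsen equation with \<open>b = 1\<close> and the equation on the
  unstable manifold with \<open>b\<close> the coefficient \<open>B_coef\<close>. The rate is bounded
  only while \<open>\<bar>\<beta> t\<bar> < 1\<close>, since the coefficient estimates hold only
  there.\<close>

locale logistic_flow =
  fixes K :: real and \<beta> b :: "real \<Rightarrow> real"
  assumes K: "K > 0"
    and ode: "\<And>t. t \<ge> 0 \<Longrightarrow> (\<beta> has_real_derivative K / 2 * \<beta> t * (1 - (\<beta> t)\<^sup>2) * b t) (at t within {0..})"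
    and b: "\<And>t. t \<ge> 0 \<Longrightarrow> \<bar>\<beta> t\<bar> < 1 \<Longrightarrow> 0 \<le> b t \<and> b t \<le> 2"
    and init: "0 \<le> \<beta> 0" "\<beta> 0 < 1"
begin

lemma continuous: "continuous_on {0..} \<beta>"
  by (rule DERIV_continuous_on[OF ode]) simp

text \<open>A first-exit argument: before the first time \<open>s\<close> at which the modulus
  reaches \<open>1\<close> the rate is bounded, so \<open>1 - \<beta>\<^sup>2\<close> decays at most
  exponentially and cannot vanish at \<open>s\<close>.\<close>

lemma abs_less_1:
  assumes "t \<ge> 0"
  shows "\<bar>\<beta> t\<bar> < 1"
proof (rule ccontr)
  assume t: "\<not> \<bar>\<beta> t\<bar> < 1"
  define S where "S = {0..t} \<inter> (\<lambda>s. \<bar>\<beta> s\<bar>) -` {1..}"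
  have "continuous_on {0..t} (\<lambda>s. \<bar>\<beta> s\<bar>)"
    by (intro continuous_on_rabs continuous_on_subset[OF continuous]) auto
  then have "closed S" unfolding S_def by (intro continuous_closed_preimage) auto
  moreover have "bounded S" by (rule bounded_subset[of "{0..t}"]) (auto simp: S_def)
  moreover have "t \<in> S" using t assms by (auto simp: S_def)
  ultimately obtain s where s: "s \<in> S" "\<And>r. r \<in> S \<Longrightarrow> s \<le> r"
    using compact_attains_inf[of S] by (auto simp: compact_eq_bounded_closed)
  have less: "\<bar>\<beta> r\<bar> < 1" if "0 < r" "r < s" for r
    using s(2)[of r] s(1) that by (force simp: S_def)
  \<comment> \<open>The exponent comes from \<open>(\<beta> r)\<^sup>2 * b r \<le> 2\<close>, which
    bounds the decay rate of \<open>1 - \<beta>\<^sup>2\<close> by \<open>2 * K\<close>.\<close>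
  have "(1 - (\<beta> 0)\<^sup>2) * exp (2 * K * 0) \<le> (1 - (\<beta> s)\<^sup>2) * exp (2 * K * s)"
  proof (rule nondecreasing_of_derivative[OF order_refl])
    show "0 \<le> s" using s(1) by (auto simp: S_def)
    show "((\<lambda>t. (1 - (\<beta> t)\<^sup>2) * exp (2 * K * t)) has_real_derivative
        K * (1 - (\<beta> t)\<^sup>2) * (2 - (\<beta> t)\<^sup>2 * b t) * exp (2 * K * t)) (at t within {0..})" if "t \<ge> 0" for t
      by (rule derivative_eq_intros ode that refl | simp)+ (simp add: algebra_simps power2_eq_square)
    fix r assume r: "0 < r" "r < s"
    have "(\<beta> r)\<^sup>2 \<le> 1" using less[OF r] by (simp add: abs_square_le_1)
    moreover have "(\<beta> r)\<^sup>2 * b r \<le> 1 * 2"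
      using calculation b[of r] less[OF r] r by (intro mult_mono) auto
    ultimately show "0 \<le> K * (1 - (\<beta> r)\<^sup>2) * (2 - (\<beta> r)\<^sup>2 * b r) * exp (2 * K * r)"
      using K by (intro mult_nonneg_nonneg) auto
  qed
  moreover have "(1 - (\<beta> s)\<^sup>2) * exp (2 * K * s) \<le> 0"
    using s(1) by (intro mult_nonpos_nonneg) (auto simp: S_def abs_square_less_1 not_less[symmetric])
  moreover have "(\<beta> 0)\<^sup>2 < 1" using init by (simp add: abs_square_less_1)
  ultimately show False by simp
qed

lemma sq_le_1: "t \<ge> 0 \<Longrightarrow> (\<beta> t)\<^sup>2 \<le> 1"
  using abs_less_1[of t] by (simp add: abs_square_le_1)

lemma b_bounds: "t \<ge> 0 \<Longrightarrow> 0 \<le> b t" "t \<ge> 0 \<Longrightarrow> b t \<le> 2"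
  using b abs_less_1 by auto

lemma factor_le: "t \<ge> 0 \<Longrightarrow> (1 - (\<beta> t)\<^sup>2) * b t \<le> 2"
proof -
  assume t: "t \<ge> 0"
  have "(1 - (\<beta> t)\<^sup>2) * b t \<le> 1 * 2"
    using b_bounds[OF t] sq_le_1[OF t] by (intro mult_mono) auto
  then show ?thesis by simp
qed

text \<open>The square of \<beta> grows at rate at most \<open>2 * K\<close>, so its product with
  \<open>exp (- 2 * K * t)\<close> is nonincreasing. This replaces a uniqueness theorem for the zero
  solution.\<close>

lemma zero_absorbing:
  assumes "0 \<le> s" "s \<le> t" "\<beta> s = 0"
  shows "\<beta> t = 0"
proof -
  have "- (\<beta> s)\<^sup>2 * exp (- 2 * K * s) \<le> - (\<beta> t)\<^sup>2 * exp (- 2 * K * t)"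
  proof (rule nondecreasing_of_derivative[OF assms(1,2)])
    show "((\<lambda>t. - (\<beta> t)\<^sup>2 * exp (- 2 * K * t)) has_real_derivative
        K * (\<beta> t)\<^sup>2 * (2 - (1 - (\<beta> t)\<^sup>2) * b t) * exp (- 2 * K * t)) (at t within {0..})" if "t \<ge> 0" for t
      by (rule derivative_eq_intros ode that refl | simp)+ (simp add: algebra_simps power2_eq_square)
    show "0 \<le> K * (\<beta> r)\<^sup>2 * (2 - (1 - (\<beta> r)\<^sup>2) * b r) * exp (- 2 * K * r)" if "s < r" "r < t" for r
      using K factor_le[of r] that assms(1) by (intro mult_nonneg_nonneg) auto
  qed
  then have "(\<beta> t)\<^sup>2 * exp (- 2 * K * t) \<le> 0" using assms(3) by simp
  then have "(\<beta> t)\<^sup>2 \<le> 0" by (simp add: mult_le_0_iff)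
  then show ?thesis by simp
qed

lemma nonneg:
  assumes "t \<ge> 0"
  shows "0 \<le> \<beta> t"
proof (rule ccontr)
  assume t: "\<not> 0 \<le> \<beta> t"
  have "continuous_on {0..t} \<beta>" by (rule continuous_on_subset[OF continuous]) auto
  then obtain s where "0 \<le> s" "s \<le> t" "\<beta> s = 0"
    using IVT2'[of \<beta> t 0 0] t init(1) assms by auto
  with t zero_absorbing show False by auto
qed

lemma less_1: "t \<ge> 0 \<Longrightarrow> \<beta> t < 1"
  using abs_less_1[of t] by linarith

lemma mono:
  assumes "0 \<le> s" "s \<le> t"
  shows "\<beta> s \<le> \<beta> t"
proof (rule nondecreasing_of_derivative[OF assms ode])
  show "0 \<le> K / 2 * \<beta> r * (1 - (\<beta> r)\<^sup>2) * b r" if "s < r" "r < t" for r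
    using K nonneg[of r] sq_le_1[of r] b_bounds[of r] that assms(1) by (intro mult_nonneg_nonneg) auto
qed

text \<open>The rate \<open>K / 2 * b t\<close> is at most \<open>K\<close>; this is the source of
  the factor \<open>exp (K * T N)\<close> in the second case.\<close>

lemma le_exp:
  assumes "0 \<le> t"
  shows "\<beta> t \<le> \<beta> 0 * exp (K * t)"
proof -
  have "- \<beta> 0 * exp (- K * 0) \<le> - \<beta> t * exp (- K * t)"
  proof (rule nondecreasing_of_derivative[OF order_refl assms])
    show "((\<lambda>t. - \<beta> t * exp (- K * t)) has_real_derivative
        K / 2 * \<beta> t * (2 - (1 - (\<beta> t)\<^sup>2) * b t) * exp (- K * t)) (at t within {0..})" if "t \<ge> 0" for t
      by (rule derivative_eq_intros ode that refl | simp)+ (simp add: algebra_simps power2_eq_square)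
    show "0 \<le> K / 2 * \<beta> r * (2 - (1 - (\<beta> r)\<^sup>2) * b r) * exp (- K * r)" if "0 < r" "r < t" for r
      using K nonneg[of r] factor_le[of r] that by (intro mult_nonneg_nonneg) auto
  qed
  then have "\<beta> t * exp (- K * t) * exp (K * t) \<le> \<beta> 0 * exp (K * t)"
    by (intro mult_right_mono) auto
  then show ?thesis by (simp add: mult.assoc flip: exp_add)
qed

text \<open>This substitution makes the logistic equation linear. Division by zero yields the value
  \<open>0\<close> at \<open>\<beta> t = 0\<close>, so the equation is stated for positive
  \<open>\<beta> 0\<close>.\<close>

definition odds :: "real \<Rightarrow> real" where
  "odds t = (1 - (\<beta> t)\<^sup>2) / (\<beta> t)\<^sup>2"

lemma pos: "\<beta> 0 > 0 \<Longrightarrow> t \<ge> 0 \<Longrightarrow> \<beta> t > 0"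
  using mono[of 0 t] by linarith

lemma odds_nonneg: "t \<ge> 0 \<Longrightarrow> 0 \<le> odds t"
  using sq_le_1[of t] by (simp add: odds_def)

lemma odds_has_derivative:
  assumes "\<beta> 0 > 0" "t \<ge> 0"
  shows "(odds has_real_derivative - K * b t * odds t) (at t within {0..})"
proof -
  define w where "w = (\<beta> t)\<^sup>2"
  have w: "w \<noteq> 0" using pos[OF assms] by (simp add: w_def)
  have sq: "((\<lambda>t. (\<beta> t)\<^sup>2) has_real_derivative K * w * (1 - w) * b t) (at t within {0..})"
    by (rule derivative_eq_intros ode assms refl)+ (simp add: w_def power2_eq_square)
  have "((\<lambda>t. (1 - (\<beta> t)\<^sup>2) / (\<beta> t)\<^sup>2) has_real_derivative
      ((0 - K * w * (1 - w) * b t) * w - (1 - w) * (K * w * (1 - w) * b t)) / (w * w)) (at t within {0..})"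
    unfolding w_def by (intro DERIV_divide DERIV_diff DERIV_const sq[unfolded w_def] w[unfolded w_def])
  moreover have "(0 - K * w * (1 - w) * b t) * w - (1 - w) * (K * w * (1 - w) * b t)
      = w * (- K * b t * (1 - w))"
    by (simp add: algebra_simps)
  then have "((0 - K * w * (1 - w) * b t) * w - (1 - w) * (K * w * (1 - w) * b t)) / (w * w)
      = - K * b t * ((1 - w) / w)"
    using w by simp
  ultimately show ?thesis unfolding odds_def [abs_def] w_def by (simp only:)
qed

lemma odds_le:
  assumes "\<beta> 0 > 0" "t \<ge> 0"
  shows "odds t \<le> odds 0"
proof -
  have "- odds 0 \<le> - odds t"
  proof (rule nondecreasing_of_derivative[OF order_refl assms(2)])
    show "((\<lambda>t. - odds t) has_real_derivative K * b t * odds t) (at t within {0..})" if "t \<ge> 0" for t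
      using DERIV_minus[OF odds_has_derivative[OF assms(1) that]] by simp
    show "0 \<le> K * b r * odds r" if "0 < r" "r < t" for r
      using K b_bounds[of r] odds_nonneg[of r] that by (intro mult_nonneg_nonneg) auto
  qed
  then show ?thesis by simp
qed

lemma sq_eq_odds: "\<beta> 0 > 0 \<Longrightarrow> t \<ge> 0 \<Longrightarrow> (\<beta> t)\<^sup>2 = 1 / (1 + odds t)"
  using pos[of t] by (simp add: odds_def field_simps)

end

text \<open>The difference \<open>d\<close> of the odds solves
  \<open>d' = - K d - K (b1 - 1) odds1\<close>. The damping term keeps the bound uniform in time
  although the perturbation persists.\<close>

lemma logistic_flow_compare:
  assumes "logistic_flow K \<beta>1 b1" "logistic_flow K \<beta>2 (\<lambda>_. 1)"
    and b1: "\<And>t. t \<ge> 0 \<Longrightarrow> \<bar>b1 t - 1\<bar> \<le> \<epsilon>"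
    and pos: "\<beta>1 0 > 0" "\<beta>2 0 > 0" and t: "t \<ge> 0"
  shows "\<bar>\<beta>1 t - \<beta>2 t\<bar>
    \<le> (\<bar>logistic_flow.odds \<beta>1 0 - logistic_flow.odds \<beta>2 0\<bar> + \<epsilon> * logistic_flow.odds \<beta>1 0) / \<beta>2 0"
proof -
  interpret f1: logistic_flow K \<beta>1 b1 by fact
  interpret f2: logistic_flow K \<beta>2 "\<lambda>_. 1" by fact
  define d where "d t = f1.odds t - f2.odds t" for t
  \<comment> \<open>The sign \<open>\<sigma>\<close> treats the upper and the lower bound for
    \<open>d\<close> together.\<close>
  have der: "((\<lambda>t. (\<epsilon> * f1.odds 0 - \<sigma> * d t) * exp (K * t)) has_real_derivative
      K * (\<epsilon> * f1.odds 0 + \<sigma> * (b1 t - 1) * f1.odds t) * exp (K * t)) (at t within {0..})"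
    if "t \<ge> 0" for t \<sigma>
    unfolding d_def
    by (rule derivative_eq_intros f1.odds_has_derivative f2.odds_has_derivative pos that refl | simp)+
      (simp add: algebra_simps)
  have bound: "\<sigma> * d t \<le> \<bar>d 0\<bar> + \<epsilon> * f1.odds 0" if \<sigma>: "\<bar>\<sigma>\<bar> = 1" for \<sigma>
  proof -
    have "(\<epsilon> * f1.odds 0 - \<sigma> * d 0) * exp (K * 0) \<le> (\<epsilon> * f1.odds 0 - \<sigma> * d t) * exp (K * t)"
    proof (rule nondecreasing_of_derivative[OF order_refl t der])
      fix r assume r: "0 < r" "r < t"
      have "\<bar>\<sigma> * (b1 r - 1) * f1.odds r\<bar> \<le> \<epsilon> * f1.odds 0"
        unfolding abs_mult \<sigma> using b1[of r] r f1.odds_nonneg[of r] f1.odds_le[OF pos(1), of r]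
        by (auto intro!: mult_mono)
      then show "0 \<le> K * (\<epsilon> * f1.odds 0 + \<sigma> * (b1 r - 1) * f1.odds r) * exp (K * r)"
        using f1.K by (intro mult_nonneg_nonneg) (auto simp: abs_le_iff)
    qed
    then have "(\<sigma> * d t - \<epsilon> * f1.odds 0) * exp (K * t) \<le> \<sigma> * d 0 - \<epsilon> * f1.odds 0"
      by (simp add: algebra_simps)
    also have "\<sigma> * d 0 \<le> \<bar>d 0\<bar>"
      using abs_ge_self[of "\<sigma> * d 0"] \<sigma> by (simp add: abs_mult)
    also have "0 \<le> \<epsilon> * f1.odds 0"
      using b1[of 0] f1.odds_nonneg[of 0] by (intro mult_nonneg_nonneg) auto
    then have "\<bar>d 0\<bar> - \<epsilon> * f1.odds 0 \<le> \<bar>d 0\<bar>" by simp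
    also have "\<bar>d 0\<bar> \<le> \<bar>d 0\<bar> * exp (K * t)"
      using f1.K t by (intro mult_le_cancel_left1[THEN iffD2]) auto
    finally have "\<sigma> * d t - \<epsilon> * f1.odds 0 \<le> \<bar>d 0\<bar>" by simp
    then show ?thesis by simp
  qed
  have dt: "\<bar>d t\<bar> \<le> \<bar>d 0\<bar> + \<epsilon> * f1.odds 0"
    using bound[of 1] bound[of "-1"] by (simp add: abs_le_iff)
  have "\<bar>(\<beta>1 t)\<^sup>2 - (\<beta>2 t)\<^sup>2\<bar> = \<bar>d t\<bar> * ((\<beta>1 t)\<^sup>2 * (\<beta>2 t)\<^sup>2)"
  proof -
    have "1 + f1.odds t > 0" "1 + f2.odds t > 0"
      using f1.odds_nonneg[OF t] f2.odds_nonneg[OF t] by auto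
    then have "(\<beta>1 t)\<^sup>2 - (\<beta>2 t)\<^sup>2 = - d t * ((\<beta>1 t)\<^sup>2 * (\<beta>2 t)\<^sup>2)"
      unfolding f1.sq_eq_odds[OF pos(1) t] f2.sq_eq_odds[OF pos(2) t] d_def by (simp add: field_simps)
    then show ?thesis by (simp add: abs_mult)
  qed
  also have "\<dots> \<le> \<bar>d t\<bar> * (1 * 1)"
    using f1.sq_le_1[OF t] f2.sq_le_1[OF t] by (intro mult_left_mono mult_mono) auto
  finally have "\<bar>\<beta>1 t - \<beta>2 t\<bar> * (\<beta>1 t + \<beta>2 t) \<le> \<bar>d t\<bar>"
    using f1.nonneg[OF t] f2.nonneg[OF t]
    by (simp add: power2_eq_square square_diff_square_factored abs_mult mult.commute)
  \<comment> \<open>As \<beta>2 is nondecreasing, the sum stays above \<open>\<beta>2 0\<close>;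
    this turns a bound on squares into one on \<beta>.\<close>
  moreover have "\<bar>\<beta>1 t - \<beta>2 t\<bar> * \<beta>2 0 \<le> \<bar>\<beta>1 t - \<beta>2 t\<bar> * (\<beta>1 t + \<beta>2 t)"
    using f1.nonneg[OF t] f2.mono[of 0 t] t by (intro mult_left_mono) auto
  ultimately have "\<bar>\<beta>1 t - \<beta>2 t\<bar> * \<beta>2 0 \<le> \<bar>d 0\<bar> + \<epsilon> * f1.odds 0" using dt by linarith
  then show ?thesis using pos by (simp add: d_def field_simps)
qed

text \<open>Let \<open>z = x + i y\<close>. Along the flow \<open>z' = k (B + i D) z\<close> with a
  real \<open>k\<close>, and the second identity says that the imaginary part of \<open>z'\<close>
  times the conjugate of \<open>1 + z\<close> is \<open>k y\<close>. This yields the derivative of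
  the argument of \<open>1 + z\<close>.\<close>

lemma coef_balance:
  fixes \<beta> A :: real
  assumes \<beta>: "\<bar>\<beta>\<bar> < 1" and N: "N \<ge> 2"
  defines "x \<equiv> (- \<beta>) ^ N * cos (2 * A * real N)" and "y \<equiv> (- \<beta>) ^ N * sin (2 * A * real N)"
  shows "\<beta>\<^sup>2 * D_coef N A \<beta> = - ((1 - \<beta>\<^sup>2) * y / ((1 + x)\<^sup>2 + y\<^sup>2))"
    and "B_coef N A \<beta> * y + D_coef N A \<beta> * (x + x\<^sup>2 + y\<^sup>2) = y"
    and "1 + x > 0"
proof -
  define s c P q where "s = sin (2 * A * real N)" and "c = cos (2 * A * real N)"
    and "P = (- \<beta>) ^ (N - 2)" and "q = (- \<beta>) ^ N"
  define d where "d = 1 + \<beta> ^ (2 * N) + 2 * q * c"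
  have sc: "s\<^sup>2 = 1 - c\<^sup>2" unfolding s_def c_def by (rule sin_squared_eq)
  have xy: "x = q * c" "y = q * s" by (simp_all add: x_def y_def q_def c_def s_def)
  have q: "q = P * \<beta>\<^sup>2" using power_Suc_Suc_minus[OF N, of "- \<beta>"] by (simp add: q_def P_def)
  have "\<beta> ^ (2 * N) = q\<^sup>2" by (simp add: q_def power_minus_squared)
  then have d: "(1 + x)\<^sup>2 + y\<^sup>2 = d"
    unfolding xy d_def power_mult_distrib sc by (simp add: power2_eq_square algebra_simps)
  note id = coef_identities[OF \<beta> N, of A, folded s_def c_def P_def q_def, folded d_def]
  show "\<beta>\<^sup>2 * D_coef N A \<beta> = - ((1 - \<beta>\<^sup>2) * y / ((1 + x)\<^sup>2 + y\<^sup>2))"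
    unfolding d id(2) unfolding xy q by (simp add: mult_ac)
  have r: "x + x\<^sup>2 + y\<^sup>2 = q * (q + c)"
    unfolding xy power_mult_distrib sc by (simp add: power2_eq_square algebra_simps)
  have "(B_coef N A \<beta> - 1) * y + D_coef N A \<beta> * (x + x\<^sup>2 + y\<^sup>2) = 0"
    unfolding id r unfolding xy by simp
  then show "B_coef N A \<beta> * y + D_coef N A \<beta> * (x + x\<^sup>2 + y\<^sup>2) = y"
    by (simp add: algebra_simps)
  have "\<bar>x\<bar> \<le> \<bar>q\<bar> * 1" unfolding xy abs_mult c_def by (intro mult_left_mono) auto
  also have "\<bar>q\<bar> < 1" using coef_denominator(3)[OF \<beta> N] by (simp add: q_def power_abs)
  finally show "1 + x > 0" by simp
qed

lemma constant_of_derivative: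
  fixes f :: "real \<Rightarrow> real"
  assumes der: "\<And>t. t \<ge> 0 \<Longrightarrow> (f has_real_derivative 0) (at t within {0..})" and t: "t \<ge> 0"
  shows "f t = f 0"
proof (rule antisym)
  show "f 0 \<le> f t"
    by (rule nondecreasing_of_derivative[OF order_refl t der]) auto
  have "- f 0 \<le> - f t"
    by (rule nondecreasing_of_derivative[OF order_refl t, where f' = "\<lambda>_. 0"])
      (use DERIV_minus[OF der] in auto)
  then show "f t \<le> f 0" by simp
qed

section \<open>Trajectories on the unstable manifold: conserved phase and drift bounds\<close>

locale Wu_flow =
  fixes K :: real and N :: nat and \<alpha> \<beta> A :: "real \<Rightarrow> real"
  assumes K: "K > 0" and N: "N \<ge> 3" and dyn: "Wu_dynamics K N \<alpha> \<beta> A"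
    and init: "0 \<le> \<beta> 0" "\<beta> 0 < 1"
begin

lemma beta_deriv:
  "t \<ge> 0 \<Longrightarrow> (\<beta> has_real_derivative K / 2 * \<beta> t * (1 - (\<beta> t)\<^sup>2) * B_coef N (A t) (\<beta> t)) (at t within {0..})"
  and alpha_deriv:
  "t \<ge> 0 \<Longrightarrow> (\<alpha> has_real_derivative K / 2 * (1 + (\<beta> t)\<^sup>2) * D_coef N (A t) (\<beta> t)) (at t within {0..})"
  and A_deriv:
  "t \<ge> 0 \<Longrightarrow> (A has_real_derivative K / 4 * (1 - (\<beta> t)\<^sup>2) * D_coef N (A t) (\<beta> t)) (at t within {0..})"
  using dyn by (auto simp: Wu_dynamics_def)

text \<open>The distance of \<open>B_coef\<close> from \<open>1\<close> is at most
  \<open>\<bar>\<beta> t\<bar>\<close>, which puts it into the required range.\<close>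

sublocale logistic_flow K \<beta> "\<lambda>t. B_coef N (A t) (\<beta> t)"
proof
  show "0 \<le> B_coef N (A t) (\<beta> t) \<and> B_coef N (A t) (\<beta> t) \<le> 2" if "\<bar>\<beta> t\<bar> < 1" for t
  proof -
    have "\<bar>B_coef N (A t) (\<beta> t) - 1\<bar> \<le> \<bar>\<beta> t\<bar>"
      using coef_abs_le(1)[OF that, of N "A t"] coef_bound_le_self[of "\<bar>\<beta> t\<bar>" N] N that by simp
    with that show ?thesis by linarith
  qed
qed (use K init beta_deriv in auto)

lemma coef_le_inverse:
  assumes "t \<ge> 0"
  shows "\<bar>B_coef N (A t) (\<beta> t) - 1\<bar> \<le> 2 / (real N - 1)" "\<bar>D_coef N (A t) (\<beta> t)\<bar> \<le> 2 / (real N - 1)"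
  using coef_abs_le[OF abs_less_1[OF assms], of N "A t"] coef_bound_le_inverse[of "\<bar>\<beta> t\<bar>" N]
    abs_less_1[OF assms] N by simp_all

lemma D_coef_le_beta:
  assumes "t \<ge> 0"
  shows "\<bar>D_coef N (A t) (\<beta> t)\<bar> \<le> \<beta> t"
  using coef_abs_le(2)[OF abs_less_1[OF assms], of N "A t"] coef_bound_le_self[of "\<bar>\<beta> t\<bar>" N]
    abs_less_1[OF assms] nonneg[OF assms] N by simp

text \<open>
  Up to the constant \<open>\<pi>\<close> this is the mean phase: if \<open>w\<^sub>1, \<dots>, w\<^sub>N\<close> are the roots of \<open>w\<^sup>N = - e\<^sup>2\<^sup>i\<^sup>A\<^sup>N\<close>, then
  \<open>(1 + \<beta> w\<^sub>1) \<cdots> (1 + \<beta> w\<^sub>N) = 1 + (- \<beta>)\<^sup>N e\<^sup>2\<^sup>i\<^sup>A\<^sup>N\<close>, whose argument is the arctangent below.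
\<close>

definition conserved :: "real \<Rightarrow> real" where
  "conserved t = 2 * A t - \<alpha> t - 2 / real N *
     arctan ((- \<beta> t) ^ N * sin (2 * A t * real N) / (1 + (- \<beta> t) ^ N * cos (2 * A t * real N)))"

text \<open>The derivative of \<open>2 * A t - \<alpha> t\<close> is
  \<open>- K * ((\<beta> t)\<^sup>2 * D)\<close>, and by \<open>coef_balance\<close> the arctangent
  term with its weight \<open>2 / N\<close> has the same derivative.\<close>

lemma conserved_has_derivative:
  assumes t: "t \<ge> 0"
  shows "(conserved has_real_derivative 0) (at t within {0..})"
proof -
  have N2: "N \<ge> 2" "N > 0" using N by auto
  define B D where "B = B_coef N (A t) (\<beta> t)" and "D = D_coef N (A t) (\<beta> t)"
  define k where "k = real N * K / 2 * (1 - (\<beta> t)\<^sup>2)"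
  define x y where "x = (- \<beta> t) ^ N * cos (2 * A t * real N)" and "y = (- \<beta> t) ^ N * sin (2 * A t * real N)"
  note bal = coef_balance[OF abs_less_1[OF t] N2(1), of "A t", folded x_def y_def B_def D_def]
  have "((\<lambda>t. (- \<beta> t) ^ N) has_real_derivative
      real N * (- (K / 2 * \<beta> t * (1 - (\<beta> t)\<^sup>2) * B) * (- \<beta> t) ^ (N - 1))) (at t within {0..})"
    using DERIV_power[OF DERIV_minus[OF beta_deriv[OF t]], of N] by (simp add: B_def)
  moreover have "real N * (- (K / 2 * \<beta> t * (1 - (\<beta> t)\<^sup>2) * B) * (- \<beta> t) ^ (N - 1)) = k * B * (- \<beta> t) ^ N"
    using power_eq_if[of "- \<beta> t" N] N2 by (simp add: k_def)
  ultimately have dq: "((\<lambda>t. (- \<beta> t) ^ N) has_real_derivative k * B * (- \<beta> t) ^ N) (at t within {0..})"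
    by simp
  have dA: "((\<lambda>t. 2 * A t * real N) has_real_derivative k * D) (at t within {0..})"
    by (rule derivative_eq_intros A_deriv t refl)+ (simp add: k_def D_def)
  have dx: "((\<lambda>t. (- \<beta> t) ^ N * cos (2 * A t * real N)) has_real_derivative k * (B * x - D * y)) (at t within {0..})"
    by (rule derivative_eq_intros dq dA refl)+ (simp add: x_def y_def algebra_simps)
  have dy: "((\<lambda>t. (- \<beta> t) ^ N * sin (2 * A t * real N)) has_real_derivative k * (B * y + D * x)) (at t within {0..})"
    by (rule derivative_eq_intros dq dA refl)+ (simp add: x_def y_def algebra_simps)
  have "((\<lambda>t. 1 + (- \<beta> t) ^ N * cos (2 * A t * real N)) has_real_derivative 0 + k * (B * x - D * y)) (at t within {0..})"
    by (intro DERIV_add DERIV_const dx)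
  from DERIV_divide[OF dy this] bal(3)
  have "((\<lambda>t. (- \<beta> t) ^ N * sin (2 * A t * real N) / (1 + (- \<beta> t) ^ N * cos (2 * A t * real N)))
      has_real_derivative k * (B * y + D * (x + x\<^sup>2 + y\<^sup>2)) / (1 + x)\<^sup>2) (at t within {0..})"
    by (simp add: x_def[symmetric] y_def[symmetric])
      (simp add: power2_eq_square algebra_simps)
  from DERIV_chain2[OF DERIV_arctan this]
  have dR: "((\<lambda>t. arctan ((- \<beta> t) ^ N * sin (2 * A t * real N) / (1 + (- \<beta> t) ^ N * cos (2 * A t * real N))))
      has_real_derivative inverse (1 + (y / (1 + x))\<^sup>2) * (k * y / (1 + x)\<^sup>2)) (at t within {0..})"
    unfolding x_def[symmetric] y_def[symmetric] bal(2) .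
  have "1 + (y / (1 + x))\<^sup>2 = ((1 + x)\<^sup>2 + y\<^sup>2) / (1 + x)\<^sup>2"
    using bal(3) by (simp add: power_divide add_divide_distrib)
  then have "inverse (1 + (y / (1 + x))\<^sup>2) * (k * y / (1 + x)\<^sup>2) = k * y / ((1 + x)\<^sup>2 + y\<^sup>2)"
    using bal(3) by simp
  then have "2 / real N * (inverse (1 + (y / (1 + x))\<^sup>2) * (k * y / (1 + x)\<^sup>2))
      = K * ((1 - (\<beta> t)\<^sup>2) * y / ((1 + x)\<^sup>2 + y\<^sup>2))"
  proof -
    have "2 / real N * k = K * (1 - (\<beta> t)\<^sup>2)" using N2 by (simp add: k_def)
    then show ?thesis
      using \<open>inverse _ * _ = _\<close> by (simp only: times_divide_eq_right mult.assoc[symmetric])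
  qed
  also have "\<dots> = - K * ((\<beta> t)\<^sup>2 * D)" unfolding bal(1) by simp
  finally have R: "2 / real N * (inverse (1 + (y / (1 + x))\<^sup>2) * (k * y / (1 + x)\<^sup>2)) = - K * ((\<beta> t)\<^sup>2 * D)" .
  have "(conserved has_real_derivative 2 * (K / 4 * (1 - (\<beta> t)\<^sup>2) * D) - K / 2 * (1 + (\<beta> t)\<^sup>2) * D
      - 2 / real N * (inverse (1 + (y / (1 + x))\<^sup>2) * (k * y / (1 + x)\<^sup>2))) (at t within {0..})"
    unfolding conserved_def [abs_def] D_def
    by (intro DERIV_diff DERIV_cmult A_deriv alpha_deriv t dR[unfolded D_def])
  moreover have "2 * (K / 4 * (1 - (\<beta> t)\<^sup>2) * D) - K / 2 * (1 + (\<beta> t)\<^sup>2) * D - - K * ((\<beta> t)\<^sup>2 * D) = 0"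
    by (simp add: field_simps)
  ultimately show ?thesis unfolding R by simp
qed

text \<open>The speed of \<open>A\<close> is at most \<open>\<epsilon> / \<beta> 0\<close> times
  that of \<beta>, because both carry the factor \<open>1 - \<beta>\<^sup>2\<close>. The total
  increase of \<beta> is less than \<open>1\<close>.\<close>

lemma A_drift:
  assumes "\<beta> 0 > 0" "N \<ge> 5" "t \<ge> 0"
  shows "\<bar>A t - A 0\<bar> \<le> 2 / (real N - 1) / \<beta> 0"
proof -
  define \<epsilon> where "\<epsilon> = 2 / (real N - 1)"
  \<comment> \<open>For \<open>N\<close> at least \<open>5\<close> this forces \<open>B_coef\<close>
    above \<open>1 / 2\<close>, so \<beta> moves fast enough to dominate \<open>A\<close>.\<close>
  have \<epsilon>: "0 \<le> \<epsilon>" "\<epsilon> \<le> 1 / 2" using assms(2) by (simp_all add: \<epsilon>_def field_simps)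
  have bound: "\<sigma> * (A t - A 0) \<le> \<epsilon> / \<beta> 0" if \<sigma>: "\<bar>\<sigma>\<bar> = 1" for \<sigma>
  proof -
    have "\<epsilon> / \<beta> 0 * \<beta> 0 - \<sigma> * A 0 \<le> \<epsilon> / \<beta> 0 * \<beta> t - \<sigma> * A t"
    proof (rule nondecreasing_of_derivative[OF order_refl assms(3)])
      show "((\<lambda>t. \<epsilon> / \<beta> 0 * \<beta> t - \<sigma> * A t) has_real_derivative
          \<epsilon> / \<beta> 0 * (K / 2 * \<beta> t * (1 - (\<beta> t)\<^sup>2) * B_coef N (A t) (\<beta> t))
          - \<sigma> * (K / 4 * (1 - (\<beta> t)\<^sup>2) * D_coef N (A t) (\<beta> t))) (at t within {0..})" if "t \<ge> 0" for t
        by (intro DERIV_diff DERIV_cmult beta_deriv A_deriv that)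
      fix r assume r: "0 < r" "r < t"
      define B D where "B = B_coef N (A r) (\<beta> r)" and "D = D_coef N (A r) (\<beta> r)"
      have "\<bar>\<sigma> * D\<bar> \<le> \<epsilon>" using coef_le_inverse(2)[of r] r \<sigma> by (simp add: abs_mult D_def \<epsilon>_def)
      then have D: "\<sigma> * D \<le> \<epsilon>" by (simp add: abs_le_iff)
      have "\<bar>B - 1\<bar> \<le> \<epsilon>" using coef_le_inverse(1)[of r] r by (simp add: B_def \<epsilon>_def)
      then have B: "1 / 2 \<le> B" using \<epsilon> by linarith
      have "1 * (1 / 2) \<le> \<beta> r / \<beta> 0 * B"
        using B mono[of 0 r] r assms(1) by (intro mult_mono) auto
      then have "1 \<le> 2 * (\<beta> r / \<beta> 0 * B)" by linarith
      then have "\<epsilon> * 1 \<le> \<epsilon> * (2 * (\<beta> r / \<beta> 0 * B))"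
        using \<epsilon>(1) by (rule mult_left_mono)
      with D have "0 \<le> \<epsilon> * (2 * (\<beta> r / \<beta> 0 * B)) - \<sigma> * D" by simp
      moreover have "0 \<le> K / 4 * (1 - (\<beta> r)\<^sup>2)" using K sq_le_1[of r] r by simp
      ultimately have "0 \<le> K / 4 * (1 - (\<beta> r)\<^sup>2) * (\<epsilon> * (2 * (\<beta> r / \<beta> 0 * B)) - \<sigma> * D)"
        by (rule mult_nonneg_nonneg[rotated])
      also have "\<dots> = \<epsilon> / \<beta> 0 * (K / 2 * \<beta> r * (1 - (\<beta> r)\<^sup>2) * B) - \<sigma> * (K / 4 * (1 - (\<beta> r)\<^sup>2) * D)"
        using assms(1) by (simp add: field_simps)
      finally show "0 \<le> \<epsilon> / \<beta> 0 * (K / 2 * \<beta> r * (1 - (\<beta> r)\<^sup>2) * B_coef N (A r) (\<beta> r))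
          - \<sigma> * (K / 4 * (1 - (\<beta> r)\<^sup>2) * D_coef N (A r) (\<beta> r))"
        unfolding B_def D_def .
    qed
    then have "\<sigma> * (A t - A 0) \<le> \<epsilon> / \<beta> 0 * (\<beta> t - \<beta> 0)" by (simp add: algebra_simps)
    also have "\<dots> \<le> \<epsilon> / \<beta> 0 * 1"
      using less_1[OF assms(3)] assms(1) \<epsilon> by (intro mult_left_mono) auto
    finally show ?thesis by simp
  qed
  show ?thesis using bound[of 1] bound[of "-1"] by (simp add: abs_le_iff \<epsilon>_def)
qed

text \<open>By conservation, the drift of \<alpha> is twice that of \<open>A\<close> plus a change
  of the arctangent, which is at most \<open>pi\<close> and has weight \<open>2 / N\<close>.\<close>

lemma alpha_drift:
  assumes "\<beta> 0 > 0" "N \<ge> 5" "t \<ge> 0"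
  shows "\<bar>\<alpha> t - \<alpha> 0\<bar> \<le> 2 * (2 / (real N - 1) / \<beta> 0) + 2 * pi / real N"
proof -
  define R where "R t = arctan ((- \<beta> t) ^ N * sin (2 * A t * real N) / (1 + (- \<beta> t) ^ N * cos (2 * A t * real N)))" for t
  have "\<bar>R t - R 0\<bar> \<le> pi"
    using arctan_lbound arctan_ubound unfolding R_def by (smt (verit) field_sum_of_halves)
  then have "2 / real N * \<bar>R t - R 0\<bar> \<le> 2 / real N * pi" by (intro mult_left_mono) auto
  then have R: "\<bar>2 / real N * (R t - R 0)\<bar> \<le> 2 * pi / real N" unfolding abs_mult by simp
  have "conserved t = conserved 0"
    by (rule constant_of_derivative[OF conserved_has_derivative assms(3)])
  then have "\<alpha> t - \<alpha> 0 = 2 * (A t - A 0) - 2 / real N * (R t - R 0)"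
    unfolding conserved_def R_def by (simp add: algebra_simps)
  then have "\<bar>\<alpha> t - \<alpha> 0\<bar> \<le> \<bar>2 * (A t - A 0)\<bar> + \<bar>2 / real N * (R t - R 0)\<bar>"
    by (simp only: abs_triangle_ineq4)
  also have "\<dots> \<le> 2 * (2 / (real N - 1) / \<beta> 0) + 2 * pi / real N"
    using A_drift[OF assms] by (intro add_mono R) simp
  finally show ?thesis .
qed

text \<open>The speed of \<alpha> is at most \<open>K * \<beta> t\<close>, hence at most the
  derivative of \<open>\<beta> 0 * exp (K * t)\<close>.\<close>

lemma alpha_drift_short_time:
  assumes "t \<ge> 0"
  shows "\<bar>\<alpha> t - \<alpha> 0\<bar> \<le> \<beta> 0 * exp (K * t)"
proof -
  have bound: "\<sigma> * (\<alpha> t - \<alpha> 0) \<le> \<beta> 0 * exp (K * t)" if \<sigma>: "\<bar>\<sigma>\<bar> = 1" for \<sigma>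
  proof -
    have "\<beta> 0 * exp (K * 0) - \<sigma> * \<alpha> 0 \<le> \<beta> 0 * exp (K * t) - \<sigma> * \<alpha> t"
    proof (rule nondecreasing_of_derivative[OF order_refl assms])
      show "((\<lambda>t. \<beta> 0 * exp (K * t) - \<sigma> * \<alpha> t) has_real_derivative
          \<beta> 0 * (exp (K * t) * K) - \<sigma> * (K / 2 * (1 + (\<beta> t)\<^sup>2) * D_coef N (A t) (\<beta> t))) (at t within {0..})"
        if "t \<ge> 0" for t
        by (intro DERIV_diff DERIV_cmult alpha_deriv that)
          (auto intro!: derivative_eq_intros)
      fix r assume r: "0 < r" "r < t"
      define D where "D = D_coef N (A r) (\<beta> r)"
      have "\<bar>\<sigma> * ((1 + (\<beta> r)\<^sup>2) * D)\<bar> = (1 + (\<beta> r)\<^sup>2) * \<bar>D\<bar>" using \<sigma> by (simp add: abs_mult)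
      also have "\<dots> \<le> 2 * (\<beta> 0 * exp (K * r))"
        using D_coef_le_beta[of r] le_exp[of r] sq_le_1[of r] r by (intro mult_mono) (auto simp: D_def)
      finally have "0 \<le> 2 * (\<beta> 0 * exp (K * r)) - \<sigma> * ((1 + (\<beta> r)\<^sup>2) * D)" by (simp add: abs_le_iff)
      then have "0 \<le> K / 2 * (2 * (\<beta> 0 * exp (K * r)) - \<sigma> * ((1 + (\<beta> r)\<^sup>2) * D))"
        using K by (intro mult_nonneg_nonneg) auto
      then show "0 \<le> \<beta> 0 * (exp (K * r) * K) - \<sigma> * (K / 2 * (1 + (\<beta> r)\<^sup>2) * D_coef N (A r) (\<beta> r))"
        unfolding D_def[symmetric] by (simp add: algebra_simps)
    qed
    then show ?thesis using init by (simp add: algebra_simps)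
  qed
  show ?thesis using bound[of 1] bound[of "-1"] by (simp add: abs_le_iff)
qed

end

section \<open>Uniform convergence\<close>

lemma OA_dynamics_flow:
  assumes "OA_dynamics K \<alpha> \<beta>" "K > 0" "0 \<le> \<beta> 0" "\<beta> 0 < 1"
  shows "logistic_flow K \<beta> (\<lambda>_. 1)" and "t \<ge> 0 \<Longrightarrow> \<alpha> t = \<alpha> 0"
proof -
  show "logistic_flow K \<beta> (\<lambda>_. 1)"
    using assms by unfold_locales (auto simp: OA_dynamics_def)
  show "\<alpha> t = \<alpha> 0" if "t \<ge> 0"
    using assms that by (intro constant_of_derivative) (auto simp: OA_dynamics_def)
qed

lemma ennreal_tendsto_0I:
  fixes X :: "'a \<Rightarrow> ennreal"
  assumes "\<And>e::real. e > 0 \<Longrightarrow> eventually (\<lambda>x. X x \<le> ennreal e) F"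
  shows "(X \<longlongrightarrow> 0) F"
proof (rule order_tendstoI)
  fix a :: ennreal assume "0 < a"
  then obtain e :: real where e: "e > 0" "ennreal e < a"
  proof (cases a)
    case (real r)
    with \<open>0 < a\<close> show ?thesis by (intro that[of "r / 2"]) (auto simp: ennreal_less_iff)
  next
    case top
    then show ?thesis by (intro that[of 1]) auto
  qed
  show "eventually (\<lambda>x. X x < a) F"
    using assms[OF e(1)] by eventually_elim (use e(2) in auto)
qed simp

text \<open>The time set \<open>S N\<close> may vary with \<open>N\<close>: it is the half-line in
  one case and \<open>{0..T N}\<close> in the other. The Wasserstein threshold is uniform in the
  parameters, so the supremum costs nothing.\<close>

lemma SUP_wasserstein_tendsto_0:
  fixes S :: "nat \<Rightarrow> real set"
  assumes p: "p \<ge> 1"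
    and a: "a \<longlonglongrightarrow> 0" and b: "b \<longlonglongrightarrow> 0"
    and close: "eventually (\<lambda>N. \<forall>t\<in>S N. \<beta>N N t \<in> {0..<1} \<and> \<beta> t \<in> {0..<1} \<and>
        \<bar>\<alpha>N N t - \<alpha> t\<bar> \<le> a N \<and> \<bar>\<beta>N N t - \<beta> t\<bar> \<le> b N) sequentially"
  shows "(\<lambda>N. SUP t\<in>S N. wasserstein p
      (empirical_measure N (theta N (\<alpha>N N t) (\<beta>N N t) (AN N t))) (OA_measure (\<alpha> t) (\<beta> t))) \<longlonglongrightarrow> 0"
proof (rule ennreal_tendsto_0I)
  fix e :: real assume "e > 0"
  from wasserstein_uniformly_small[OF this p] obtain \<delta> where \<delta>: "\<delta> > 0"
    and small: "\<And>N \<alpha>1 \<alpha>2 \<beta>1 \<beta>2 A. \<lbrakk>0 \<le> \<beta>1; \<beta>1 < 1; 0 \<le> \<beta>2; \<beta>2 < 1; N > 0; 1 / real N \<le> \<delta>;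
        \<bar>\<alpha>1 - \<alpha>2\<bar> \<le> \<delta>; \<bar>\<beta>1 - \<beta>2\<bar> \<le> \<delta>\<rbrakk>
      \<Longrightarrow> wasserstein p (empirical_measure N (theta N \<alpha>1 \<beta>1 A)) (OA_measure \<alpha>2 \<beta>2) \<le> ennreal e"
    by metis
  have "eventually (\<lambda>N. 1 / real N < \<delta>) sequentially"
    by (rule order_tendstoD(2)[OF lim_1_over_n \<delta>])
  moreover have "eventually (\<lambda>N. a N < \<delta>) sequentially" "eventually (\<lambda>N. b N < \<delta>) sequentially"
    using order_tendstoD(2)[OF a \<delta>] order_tendstoD(2)[OF b \<delta>] .
  ultimately show "eventually (\<lambda>N. (SUP t\<in>S N. wasserstein p
      (empirical_measure N (theta N (\<alpha>N N t) (\<beta>N N t) (AN N t))) (OA_measure (\<alpha> t) (\<beta> t))) \<le> ennreal e) sequentially"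
    using close eventually_gt_at_top[of 0]
  proof eventually_elim
    case (elim N)
    then show ?case by (intro SUP_least small) force+
  qed
qed

theorem theorem4p6:
  fixes K p :: real
    and \<alpha> \<beta> :: "real \<Rightarrow> real"
    and \<alpha>N \<beta>N AN :: "nat \<Rightarrow> real \<Rightarrow> real"
  assumes "K > 0" and "p \<ge> 1"
    and "\<alpha> 0 \<in> {- pi..pi}" and "\<beta> 0 \<in> {0..<1}"
    and "OA_dynamics K \<alpha> \<beta>"
    and "\<And>N. N \<ge> 3 \<Longrightarrow> (\<alpha>N N 0, \<beta>N N 0, AN N 0) \<in> Wu_params N (to_torus (\<alpha> 0))"
    and "\<And>N. N \<ge> 3 \<Longrightarrow> Wu_dynamics K N (\<alpha>N N) (\<beta>N N) (AN N)"
    and "(\<lambda>N. \<alpha>N N 0) \<longlonglongrightarrow> \<alpha> 0" and "(\<lambda>N. \<beta>N N 0) \<longlonglongrightarrow> \<beta> 0"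
  shows "(\<beta> 0 \<in> {0<..<1} \<longrightarrow>
      (\<lambda>N. SUP t\<in>{0..}. wasserstein p
         (empirical_measure N (theta N (\<alpha>N N t) (\<beta>N N t) (AN N t))) (OA_measure (\<alpha> t) (\<beta> t)))
      \<longlonglongrightarrow> 0)
    \<and> (\<beta> 0 = 0 \<longrightarrow> (\<forall>T :: nat \<Rightarrow> real.
      filterlim T at_top sequentially \<longrightarrow> (\<lambda>N. \<beta>N N 0 * exp (K * T N)) \<longlonglongrightarrow> 0 \<longrightarrow>
      (\<lambda>N. SUP t\<in>{0..T N}. wasserstein p
         (empirical_measure N (theta N (\<alpha>N N t) (\<beta>N N t) (AN N t))) (OA_measure (\<alpha> t) (\<beta> t)))
      \<longlonglongrightarrow> 0))"
proof (intro conjI impI allI)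
  have flow: "Wu_flow K N (\<alpha>N N) (\<beta>N N) (AN N)" if "N \<ge> 3" for N
    using assms(1,6,7) that by unfold_locales (auto simp: Wu_params_def)
  have \<beta>0: "0 \<le> \<beta> 0" "\<beta> 0 < 1" using assms(4) by auto
  interpret OA: logistic_flow K \<beta> "\<lambda>_. 1"
    by (rule OA_dynamics_flow(1)[OF assms(5,1) \<beta>0])
  have \<alpha>_const: "\<alpha> t = \<alpha> 0" if "t \<ge> 0" for t
    by (rule OA_dynamics_flow(2)[OF assms(5,1) \<beta>0 that])
  have \<alpha>_init: "(\<lambda>N. \<bar>\<alpha>N N 0 - \<alpha> 0\<bar>) \<longlonglongrightarrow> 0"
    using tendsto_rabs[OF tendsto_diff[OF assms(8) tendsto_const[of "\<alpha> 0"]]] by simp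
  have inv_lim: "(\<lambda>N. 2 / (real N - 1)) \<longlonglongrightarrow> 0"
    by real_asymp
  {
    assume "\<beta> 0 \<in> {0<..<1}"
    then have pos: "\<beta> 0 > 0" by simp
    \<comment> \<open>The initial odds of \<open>\<beta>N N\<close>, written out so that their limit
      can be taken over all \<open>N\<close>.\<close>
    define v where "v N = (1 - (\<beta>N N 0)\<^sup>2) / (\<beta>N N 0)\<^sup>2" for N
    have v: "v \<longlonglongrightarrow> OA.odds 0"
      unfolding v_def [abs_def] OA.odds_def using pos by (intro tendsto_intros assms(9)) auto
    define a where "a N = \<bar>\<alpha>N N 0 - \<alpha> 0\<bar> + (2 * (2 / (real N - 1) / \<beta>N N 0) + 2 * pi / real N)" for N
    have "(\<lambda>N. 2 * (2 / (real N - 1) / \<beta>N N 0)) \<longlonglongrightarrow> 2 * (0 / \<beta> 0)"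
      using pos by (intro tendsto_intros inv_lim assms(9)) auto
    moreover have "(\<lambda>N. 2 * pi / real N) \<longlonglongrightarrow> 0" by real_asymp
    ultimately have "a \<longlonglongrightarrow> 0 + (2 * (0 / \<beta> 0) + 0)"
      unfolding a_def [abs_def] by (intro tendsto_add \<alpha>_init)
    then have a: "a \<longlonglongrightarrow> 0" by simp
    \<comment> \<open>The bound of \<open>logistic_flow_compare\<close> with
      \<open>\<epsilon> = 2 / (N - 1)\<close>.\<close>
    define b where "b N = (\<bar>v N - OA.odds 0\<bar> + 2 / (real N - 1) * v N) / \<beta> 0" for N
    have "b \<longlonglongrightarrow> (\<bar>OA.odds 0 - OA.odds 0\<bar> + 0 * OA.odds 0) / \<beta> 0"
      unfolding b_def [abs_def] using pos by (intro tendsto_intros v inv_lim) auto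
    then have b: "b \<longlonglongrightarrow> 0" by simp
    have "eventually (\<lambda>N. \<beta>N N 0 > 0) sequentially"
      by (rule order_tendstoD(1)[OF assms(9) pos])
    then have "eventually (\<lambda>N. \<forall>t\<in>{0..}. \<beta>N N t \<in> {0..<1} \<and> \<beta> t \<in> {0..<1} \<and>
        \<bar>\<alpha>N N t - \<alpha> t\<bar> \<le> a N \<and> \<bar>\<beta>N N t - \<beta> t\<bar> \<le> b N) sequentially"
      using eventually_ge_at_top[of 5]
    proof eventually_elim
      case (elim N)
      interpret W: Wu_flow K N "\<alpha>N N" "\<beta>N N" "AN N" using flow[of N] elim by simp
      show ?case
      proof
        fix t :: real assume "t \<in> {0..}"
        then have t: "t \<ge> 0" by simp
        have "\<bar>\<alpha>N N t - \<alpha> t\<bar> \<le> a N"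
          using W.alpha_drift[OF elim t] unfolding \<alpha>_const[OF t] a_def by linarith
        moreover have "\<bar>\<beta>N N t - \<beta> t\<bar> \<le> b N"
          using logistic_flow_compare[OF W.logistic_flow_axioms OA.logistic_flow_axioms
              W.coef_le_inverse(1) elim(1) pos t]
          unfolding b_def v_def W.odds_def .
        ultimately show "\<beta>N N t \<in> {0..<1} \<and> \<beta> t \<in> {0..<1} \<and>
            \<bar>\<alpha>N N t - \<alpha> t\<bar> \<le> a N \<and> \<bar>\<beta>N N t - \<beta> t\<bar> \<le> b N"
          using W.nonneg[OF t] W.less_1[OF t] OA.nonneg[OF t] OA.less_1[OF t] by simp
      qed
    qed
    from SUP_wasserstein_tendsto_0[OF assms(2) a b this]
    show "(\<lambda>N. SUP t\<in>{0..}. wasserstein p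
         (empirical_measure N (theta N (\<alpha>N N t) (\<beta>N N t) (AN N t))) (OA_measure (\<alpha> t) (\<beta> t))) \<longlonglongrightarrow> 0" .
  next
    fix T :: "nat \<Rightarrow> real"
    assume zero: "\<beta> 0 = 0" and T: "(\<lambda>N. \<beta>N N 0 * exp (K * T N)) \<longlonglongrightarrow> 0"
    have a: "(\<lambda>N. \<bar>\<alpha>N N 0 - \<alpha> 0\<bar> + \<beta>N N 0 * exp (K * T N)) \<longlonglongrightarrow> 0"
      using tendsto_add[OF \<alpha>_init T] by simp
    have "eventually (\<lambda>N. \<forall>t\<in>{0..T N}. \<beta>N N t \<in> {0..<1} \<and> \<beta> t \<in> {0..<1} \<and>
        \<bar>\<alpha>N N t - \<alpha> t\<bar> \<le> \<bar>\<alpha>N N 0 - \<alpha> 0\<bar> + \<beta>N N 0 * exp (K * T N) \<and>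
        \<bar>\<beta>N N t - \<beta> t\<bar> \<le> \<beta>N N 0 * exp (K * T N)) sequentially"
      using eventually_ge_at_top[of 3]
    proof eventually_elim
      case (elim N)
      interpret W: Wu_flow K N "\<alpha>N N" "\<beta>N N" "AN N" by (rule flow[OF elim])
      show ?case
      proof
        fix t :: real assume "t \<in> {0..T N}"
        then have t: "t \<ge> 0" "t \<le> T N" by auto
        have exp: "\<beta>N N 0 * exp (K * t) \<le> \<beta>N N 0 * exp (K * T N)"
          using t assms(1) W.init by (intro mult_left_mono) auto
        \<comment> \<open>The limit profile stays uniform, so the error in \<beta> is
          \<open>\<beta>N N t\<close> itself.\<close>
        have "\<beta> t = 0" by (rule OA.zero_absorbing[OF order_refl t(1) zero])
        then show "\<beta>N N t \<in> {0..<1} \<and> \<beta> t \<in> {0..<1} \<and>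
            \<bar>\<alpha>N N t - \<alpha> t\<bar> \<le> \<bar>\<alpha>N N 0 - \<alpha> 0\<bar> + \<beta>N N 0 * exp (K * T N) \<and>
            \<bar>\<beta>N N t - \<beta> t\<bar> \<le> \<beta>N N 0 * exp (K * T N)"
          using exp W.alpha_drift_short_time[OF t(1)] W.le_exp[OF t(1)] W.nonneg[OF t(1)] W.less_1[OF t(1)]
          unfolding \<alpha>_const[OF t(1)] by (auto simp: abs_le_iff)
      qed
    qed
    from SUP_wasserstein_tendsto_0[OF assms(2) a T this]
    show "(\<lambda>N. SUP t\<in>{0..T N}. wasserstein p
         (empirical_measure N (theta N (\<alpha>N N t) (\<beta>N N t) (AN N t))) (OA_measure (\<alpha> t) (\<beta> t))) \<longlonglongrightarrow> 0" .
  }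
qed

end
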